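(* Let $(\Sigma,m)$ be a weighted simplicial complex of dimension $d$. (a) Suppose that for every $(d-1)$-dimensional simplex $\sigma\in\Sigma$ there is an $\omega\in\ell^2(\Sigma,m)$ supported in $\Sigma_d$ such that $\partial\omega=1_\sigma$. Then the link graph $b_\rho$ of every $(d-2)$-dimensional simplex $\rho$ has a transient connected component. (b) If a connected component of the link graph $b_\rho$ of some simplex $\rho\in\Sigma$ is transient, then for every vertex $v$ in this component there is an $\omega\in\ell^2(\Sigma,m)$ such that for all $\tau\succ\rho$, $$\partial\omega(\tau)=1_{v\rho}(\tau).$$
   Context: Weighted simplicial complexes. Let $X$ be a discrete set (of vertices). A simplicial complex $\hat\Sigma$ over $X$ is a (non-empty) set of finite subsets of $X$ closed under taking subsets, whose $0$-simplices are identified with $X$; it contains $\varnothing$. A simplex with $k+1$ elements has dimension $k$, and the dimension of the complex is the supremum of the dimensions of its simplices. Write $\tau\prec\sigma$ (or $\sigma\succ\tau$) if $\tau\subseteq\sigma$ and $|\sigma\setminus\tau|=1$; then $\tau$ is a face of $\sigma$ and $\sigma$ a coface of $\tau$. Let $m:\hat\Sigma\to(0,\infty)$. Put $\Sigma=\hat\Sigma$ if $\sum_{x\in X}m(x)<\infty$ and $\Sigma=\hat\Sigma\setminus\{\varnothing\}$ otherwise. Assume $m$ is locally summable: $\sum_{\sigma\succ\tau}m(\sigma)<\infty$ for all $\tau\in\Sigma$. Then $(\Sigma,m)$ is called a weighted simplicial complex; no local finiteness is assumed. All simplices below range over $\Sigma$, and $\Sigma_k$ is the set of $k$-dimensional simplices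 in $\Sigma$. $C(\Sigma)$ denotes the complex functions on $\Sigma$, $1_\sigma$ is the characteristic function of $\sigma\in\Sigma$, and $\ell^2(\Sigma,m)=\{\omega\in C(\Sigma):\sum_{\tau\in\Sigma} m(\tau)|\omega(\tau)|^2<\infty\}$. Coboundary and boundary. Fix a coboundary operator, i.e. a linear operator $\delta:C(\Sigma)\to C(\Sigma)$ of the form $\delta\omega(\sigma)=\sum_{\tau\prec\sigma}\theta(\tau,\sigma)\omega(\tau)$ (a finite sum) with $\theta(\tau,\sigma)=\delta 1_\tau(\sigma)\in\{\pm1\}$ for $\tau\prec\sigma$, satisfying $\delta\delta=0$. The boundary operator $\partial:D(\partial)\to C(\Sigma)$ is $$\partial\omega(\rho)=\frac1{m(\rho)}\sum_{\tau\succ\rho}m(\tau)\theta(\rho,\tau)\omega(\tau),\qquad D(\partial)=\Big\{\omega\in C(\Sigma):\sum_{\tau\succ\rho}m(\tau)|\omega(\tau)|<\infty\text{ for all }\rho\in\Sigma\Big\}.$$ One has $\ell^2(\Sigma,m)\subseteq D(\partial)$. Links. For $\rho\in\Sigma$, $\mathrm{lk}(\rho)=\{v\in X: v\cup\rho\in\Sigma,\ v\cup\rho\succ\rho\}$ (identifying the vertex $v$ with $\{v\}$), with $v\rho=v\cup\rho$ and $vv'\rho=v\cup v'\cup\rho$. The link graph is the symmetric function $b_\rho:\mathrm{lk}(\rho)\times\mathrm{lk}(\rho)\to[0,\infty)$, $b_\rho(v,v')=m(vv'\rho)$ if $v\ne v'$ and $vv'\rho\in\Sigma$, and $b_\rho(v,v')=0$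 otherwise. Local summability gives $\sum_{v'}b_\rho(v,v')<\infty$ for all $v\in\mathrm{lk}(\rho)$. Connected components are the classes of vertices joined by finite paths along which $b_\rho>0$. Recurrence and transience. A connected graph $b$ over $X$ is recurrent if the Markov chain $(Y_n)$ with transition probabilities $\mathbb P(Y_n=y\mid Y_{n-1}=x)=b(x,y)/\sum_z b(x,z)$ satisfies $\mathbb P(Y_k=y\text{ for some }k>0\mid Y_0=x)=1$ for all $x,y$; equivalently, the constant function $1$ is a pointwise limit of finitely supported functions $\varphi_n$ with $\frac12\sum_{x,y}b(x,y)|\varphi_n(x)-\varphi_n(y)|^2\to0$. A component consisting of a single vertex counts as recurrent. A connected graph that is not recurrent is called transient.
   Formalization: In (a) the conclusion is stated only for (d-2)-dimensional simplices ρ whose link is non-empty; for a ρ with empty link (e.g. an isolated vertex when d = 2) the link graph has no component at all, so the claim as written fails. *)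

theory Defs
  imports "HOL-Probability.Probability"
begin

section \<open>Weighted simplicial complexes\<close>

definition abstract_simplicial_complex :: "'a set \<Rightarrow> 'a set set \<Rightarrow> bool" where
  "abstract_simplicial_complex X K \<longleftrightarrow>
     K \<noteq> {} \<and> (\<forall>\<sigma>\<in>K. finite \<sigma> \<and> \<sigma> \<subseteq> X) \<and> (\<forall>\<sigma>\<in>K. \<forall>\<tau>. \<tau> \<subseteq> \<sigma> \<longrightarrow> \<tau> \<in> K) \<and> (\<forall>x\<in>X. {x} \<in> K)"

text \<open>\<open>codim1_face \<tau> \<sigma>\<close> is the relation \<open>\<tau> \<prec> \<sigma>\<close>, i.e. \<open>\<tau>\<close> has codimension one in \<open>\<sigma>\<close>.\<close>

definition codim1_face :: "'a set \<Rightarrow> 'a set \<Rightarrow> bool" where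
  "codim1_face \<tau> \<sigma> \<longleftrightarrow> \<tau> \<subseteq> \<sigma> \<and> card (\<sigma> - \<tau>) = 1"

definition faces :: "'a set set \<Rightarrow> 'a set \<Rightarrow> 'a set set" where
  "faces S \<sigma> = {\<tau>\<in>S. codim1_face \<tau> \<sigma>}"

definition cofaces :: "'a set set \<Rightarrow> 'a set \<Rightarrow> 'a set set" where
  "cofaces S \<tau> = {\<sigma>\<in>S. codim1_face \<tau> \<sigma>}"

definition simplex_dim :: "'a set \<Rightarrow> int" where
  "simplex_dim \<sigma> = int (card \<sigma>) - 1"

definition simplices :: "'a set set \<Rightarrow> int \<Rightarrow> 'a set set" where
  "simplices S k = {\<sigma>\<in>S. simplex_dim \<sigma> = k}"

definition complex_dim :: "'a set set \<Rightarrow> ereal" where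
  "complex_dim S = (SUP \<sigma>\<in>S. ereal (of_int (simplex_dim \<sigma>)))"

text \<open>
  \<open>K\<close> is the full complex, which contains the empty simplex. \<open>S\<close> retains the empty simplex
  exactly if the total vertex weight is finite.
\<close>

definition weighted_simplicial_complex ::
  "'a set \<Rightarrow> 'a set set \<Rightarrow> ('a set \<Rightarrow> real) \<Rightarrow> 'a set set \<Rightarrow> bool" where
  "weighted_simplicial_complex X K m S \<longleftrightarrow>
     abstract_simplicial_complex X K \<and>
     (\<forall>\<sigma>\<in>K. 0 < m \<sigma>) \<and>
     S = (if (\<lambda>x. m {x}) summable_on X then K else K - {{}}) \<and>
     (\<forall>\<tau>\<in>S. m summable_on cofaces S \<tau>)"

section \<open>Coboundary and boundary\<close>

text \<open>
  Functions on \<open>S\<close> are represented by total functions; their values outside \<open>S\<close> are never used.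
\<close>

definition coboundary ::
  "'a set set \<Rightarrow> ('a set \<Rightarrow> 'a set \<Rightarrow> complex) \<Rightarrow> ('a set \<Rightarrow> complex) \<Rightarrow> 'a set \<Rightarrow> complex" where
  "coboundary S \<theta> \<omega> \<sigma> = (\<Sum>\<tau>\<in>faces S \<sigma>. \<theta> \<tau> \<sigma> * \<omega> \<tau>)"

text \<open>
  A coboundary operator is determined by its coefficients \<open>\<theta> \<tau> \<sigma>\<close> for \<open>\<tau> \<prec> \<sigma>\<close>, so it is
  given here by \<open>\<theta>\<close>; values of \<open>\<theta>\<close> on other pairs are never used.
\<close>

definition coboundary_coeffs ::
  "'a set set \<Rightarrow> ('a set \<Rightarrow> 'a set \<Rightarrow> complex) \<Rightarrow> bool" where
  "coboundary_coeffs S \<theta> \<longleftrightarrow>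
     (\<forall>\<sigma>\<in>S. \<forall>\<tau>\<in>faces S \<sigma>. \<theta> \<tau> \<sigma> \<in> {1, -1}) \<and>
     (\<forall>\<omega>. \<forall>\<sigma>\<in>S. coboundary S \<theta> (coboundary S \<theta> \<omega>) \<sigma> = 0)"

definition l2 :: "'a set set \<Rightarrow> ('a set \<Rightarrow> real) \<Rightarrow> ('a set \<Rightarrow> complex) set" where
  "l2 S m = {\<omega>. (\<lambda>\<tau>. m \<tau> * (cmod (\<omega> \<tau>))\<^sup>2) summable_on S}"

definition boundary_domain :: "'a set set \<Rightarrow> ('a set \<Rightarrow> real) \<Rightarrow> ('a set \<Rightarrow> complex) set" where
  "boundary_domain S m = {\<omega>. \<forall>\<rho>\<in>S. (\<lambda>\<tau>. m \<tau> * cmod (\<omega> \<tau>)) summable_on cofaces S \<rho>}"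

text \<open>Meaningful for \<open>\<omega> \<in> boundary_domain S m\<close>; this includes \<open>l2 S m\<close>, as shown next.\<close>

definition boundary ::
  "'a set set \<Rightarrow> ('a set \<Rightarrow> real) \<Rightarrow> ('a set \<Rightarrow> 'a set \<Rightarrow> complex) \<Rightarrow>
     ('a set \<Rightarrow> complex) \<Rightarrow> 'a set \<Rightarrow> complex" where
  "boundary S m \<theta> \<omega> \<rho> =
     (1 / of_real (m \<rho>)) * (\<Sum>\<^sub>\<infinity>\<tau>\<in>cofaces S \<rho>. of_real (m \<tau>) * \<theta> \<rho> \<tau> * \<omega> \<tau>)"

lemma l2_subset_boundary_domain:
  assumes "weighted_simplicial_complex X K m S"
  shows "l2 S m \<subseteq> boundary_domain S m"
proof
  fix \<omega> assume "\<omega> \<in> l2 S m"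
  then have l2: "(\<lambda>\<tau>. m \<tau> * (cmod (\<omega> \<tau>))\<^sup>2) summable_on S"
    by (simp add: l2_def)
  have pos: "0 < m \<tau>" if "\<tau> \<in> S" for \<tau>
    using assms that by (auto simp: weighted_simplicial_complex_def split: if_splits)
  have "(\<lambda>\<tau>. m \<tau> * cmod (\<omega> \<tau>)) summable_on cofaces S \<rho>" if \<rho>: "\<rho> \<in> S" for \<rho>
  proof (rule summable_on_comparison_test)
    show "(\<lambda>\<tau>. m \<tau> + m \<tau> * (cmod (\<omega> \<tau>))\<^sup>2) summable_on cofaces S \<rho>"
      using assms \<rho> summable_on_subset_banach[OF l2, of "cofaces S \<rho>"]
      by (intro summable_on_add) (auto simp: weighted_simplicial_complex_def cofaces_def)
    fix \<tau> assume "\<tau> \<in> cofaces S \<rho>"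
    then have "0 < m \<tau>" using pos by (auto simp: cofaces_def)
    moreover have "t \<le> 1 + t\<^sup>2" for t :: real
      using zero_le_power2[of "t - 1 / 2"] by (simp add: power2_eq_square algebra_simps)
    ultimately have "m \<tau> * cmod (\<omega> \<tau>) \<le> m \<tau> * (1 + (cmod (\<omega> \<tau>))\<^sup>2)"
      by (intro mult_left_mono) auto
    then show "m \<tau> * cmod (\<omega> \<tau>) \<le> m \<tau> + m \<tau> * (cmod (\<omega> \<tau>))\<^sup>2"
      by (simp add: distrib_left)
    show "0 \<le> m \<tau> * cmod (\<omega> \<tau>)" using \<open>0 < m \<tau>\<close> by simp
  qed
  then show "\<omega> \<in> boundary_domain S m" by (simp add: boundary_domain_def)
qed

section \<open>Links\<close>

definition link :: "'a set set \<Rightarrow> 'a set \<Rightarrow> 'a set" where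
  "link S \<rho> = {v. insert v \<rho> \<in> S \<and> codim1_face \<rho> (insert v \<rho>)}"

definition link_graph :: "'a set set \<Rightarrow> ('a set \<Rightarrow> real) \<Rightarrow> 'a set \<Rightarrow> 'a \<Rightarrow> 'a \<Rightarrow> real" where
  "link_graph S m \<rho> v v' =
     (if v \<in> link S \<rho> \<and> v' \<in> link S \<rho> \<and> v \<noteq> v' \<and> {v, v'} \<union> \<rho> \<in> S then m ({v, v'} \<union> \<rho>) else 0)"

section \<open>Connectedness and recurrence of weighted graphs\<close>

definition graph_joined :: "'a set \<Rightarrow> ('a \<Rightarrow> 'a \<Rightarrow> real) \<Rightarrow> 'a \<Rightarrow> 'a \<Rightarrow> bool" where
  "graph_joined V b = (\<lambda>x y. x \<in> V \<and> y \<in> V \<and> 0 < b x y)\<^sup>*\<^sup>*"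

definition connected_graph :: "'a set \<Rightarrow> ('a \<Rightarrow> 'a \<Rightarrow> real) \<Rightarrow> bool" where
  "connected_graph V b \<longleftrightarrow> V \<noteq> {} \<and> (\<forall>x\<in>V. \<forall>y\<in>V. graph_joined V b x y)"

definition graph_components :: "'a set \<Rightarrow> ('a \<Rightarrow> 'a \<Rightarrow> real) \<Rightarrow> 'a set set" where
  "graph_components V b = (\<lambda>x. {y\<in>V. graph_joined V b x y}) ` V"

text \<open>
  The law on path space of the Markov chain with transition probabilities \<open>p\<close> started at \<open>x\<close>,
  obtained from the Ionescu-Tulcea theorem.
\<close>

definition chain_step :: "('a \<Rightarrow> 'a pmf) \<Rightarrow> 'a \<Rightarrow> nat \<Rightarrow> (nat \<Rightarrow> 'a) \<Rightarrow> 'a measure" where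
  "chain_step p x n Y = measure_pmf (if n = 0 then return_pmf x else p (Y (n - 1)))"

lemma Ionescu_Tulcea_chain_step: "Ionescu_Tulcea (chain_step p x) (\<lambda>_. count_space UNIV)"
proof (rule Ionescu_Tulcea.intro)
  fix n
  show "chain_step p x n \<in> measurable (PiM {0..<n} (\<lambda>_. count_space UNIV)) (subprob_algebra (count_space UNIV))"
  proof (cases n)
    case 0
    then have "chain_step p x n = (\<lambda>_. measure_pmf (return_pmf x))"
      by (simp add: chain_step_def fun_eq_iff)
    moreover have "measure_pmf (return_pmf x) \<in> space (subprob_algebra (count_space UNIV))"
      by (auto simp: space_subprob_algebra intro!: measure_pmf.subprob_space_axioms)
    ultimately show ?thesis
      by simp
  next
    case (Suc k)
    have "(\<lambda>y. measure_pmf (p y)) \<in> measurable (count_space UNIV) (subprob_algebra (count_space UNIV))"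
      by (auto simp: space_subprob_algebra intro!: measure_pmf.subprob_space_axioms)
    moreover have "(\<lambda>Y. Y k) \<in> measurable (PiM {0..<n} (\<lambda>_. count_space UNIV)) (count_space UNIV)"
      using Suc by (intro measurable_component_singleton) auto
    ultimately have "(\<lambda>Y. measure_pmf (p (Y k)))
        \<in> measurable (PiM {0..<n} (\<lambda>_. count_space UNIV)) (subprob_algebra (count_space UNIV))"
      by (rule measurable_compose[rotated])
    moreover have "chain_step p x n = (\<lambda>Y. measure_pmf (p (Y k)))"
      using Suc by (simp add: chain_step_def fun_eq_iff)
    ultimately show ?thesis
      by (simp only:)
  qed
next
  fix n Y
  show "prob_space (chain_step p x n Y)"
    unfolding chain_step_def by (rule measure_pmf.prob_space_axioms)
qed

definition chain_law :: "('a \<Rightarrow> 'a pmf) \<Rightarrow> 'a \<Rightarrow> (nat \<Rightarrow> 'a) measure" where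
  "chain_law p x =
     projective_family.lim UNIV
       (Ionescu_Tulcea.CI (chain_step p x) (\<lambda>_. count_space UNIV)) (\<lambda>_. count_space UNIV)"

text \<open>
  The transition probabilities form a probability distribution whenever the total weight at \<open>x\<close> is
  finite and positive; in a connected graph with at least two vertices it is positive at every
  vertex.
\<close>

definition graph_step :: "'a set \<Rightarrow> ('a \<Rightarrow> 'a \<Rightarrow> real) \<Rightarrow> 'a \<Rightarrow> 'a pmf" where
  "graph_step V b x = embed_pmf (\<lambda>y. if y \<in> V then b x y / (\<Sum>\<^sub>\<infinity>z\<in>V. b x z) else 0)"

definition recurrent_graph :: "'a set \<Rightarrow> ('a \<Rightarrow> 'a \<Rightarrow> real) \<Rightarrow> bool" where
  "recurrent_graph V b \<longleftrightarrow> connected_graph V b \<and>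
     ((\<exists>x. V = {x}) \<or>
      (\<forall>x\<in>V. \<forall>y\<in>V. measure (chain_law (graph_step V b) x) {Y. \<exists>k>0. Y k = y} = 1))"

definition transient_graph :: "'a set \<Rightarrow> ('a \<Rightarrow> 'a \<Rightarrow> real) \<Rightarrow> bool" where
  "transient_graph V b \<longleftrightarrow> connected_graph V b \<and> \<not> recurrent_graph V b"

end

theory Submission
  imports Defs
begin

text \<open>
  Both parts rest on a translation between boundaries near \<open>\<rho>\<close> and currents on the link graph
  \<open>b\<close> of \<open>\<rho>\<close>. An edge \<open>(u, w)\<close> of the link graph is a simplex \<open>\<tau> = {u, w} \<union> \<rho>\<close>, and \<open>\<omega>\<close> is
  turned, with \<open>u\<rho>\<close> for \<open>insert u \<rho>\<close>, into the function \<open>A u w = \<theta> \<rho> (u\<rho>) * \<theta> (u\<rho>) \<tau> * \<omega> \<tau>\<close> on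
  oriented edges. Applying \<open>\<delta>\<delta> = 0\<close> to \<open>1\<^sub>\<rho>\<close> gives
  \<open>\<theta> \<rho> (u\<rho>) * \<theta> (u\<rho>) \<tau> = - \<theta> \<rho> (w\<rho>) * \<theta> (w\<rho>) \<tau>\<close>
  (\<open>coboundary_squared_two_terms\<close>), so \<open>A\<close> is antisymmetric; its divergence at \<open>u\<close> is
  \<open>\<theta> \<rho> (u\<rho>) * m (u\<rho>)\<close> times the boundary of \<open>\<omega>\<close> at \<open>u\<rho>\<close>, and its energy is controlled by the norm of
  \<open>\<omega>\<close> in \<open>\<ell>\<^sup>2\<close>. Hence \<open>\<partial>\<omega> = 1\<close> at \<open>v\<rho>\<close> and \<open>0\<close> at the other cofaces of \<open>\<rho>\<close> says that \<open>A\<close> is, up to a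
  factor, a unit flow of finite energy from \<open>v\<close> to infinity. What remains is the classical criterion
  that such a flow exists exactly on transient graphs, for graphs that need not be locally finite.

  The criterion is proved with the truncated Green function \<open>g\<^sub>N u\<close>, the expected number of visits to
  \<open>v\<close> before time \<open>N\<close> from \<open>u\<close>. Write \<open>P f u\<close> for the expectation of \<open>f\<close> after one step from \<open>u\<close>.
  Since \<open>g\<^sub>N - P g\<^sub>N \<le> 1\<^sub>v\<close> and \<open>g\<^sub>N\<close> is summable against the vertex
  degrees, summation by parts bounds its energy by \<open>2 * deg v * g\<^sub>N v\<close> (\<open>green_trunc_energy\<close>).

  Part (a): pairing the gradient of \<open>g\<^sub>N\<close> with a flow of finite energy and estimating as in the
  Cauchy--Schwarz inequality gives \<open>(g\<^sub>N v)\<^sup>2 \<le> const * g\<^sub>N v\<close>, so \<open>g\<^sub>N v\<close> stays bounded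
  (\<open>flow_bounds_green_trunc\<close>). A chain that returns to \<open>v\<close> almost surely does so infinitely often and has \<open>g\<^sub>N v\<close> unbounded
  (\<open>green_unbounded_if_returns\<close>).

  Part (b): if some vertex is missed with positive probability, then \<open>g\<^sub>N\<close> is bounded for every
  \<open>v\<close> in the component (\<open>green_bounded_if_not_hitting\<close>). Its limit \<open>g\<close> satisfies \<open>g - P g = 1\<^sub>v\<close> and has
  finite energy by Fatou's lemma. The required \<open>\<omega>\<close> is a multiple of the coboundary of
  \<open>u\<rho> \<mapsto> \<theta> \<rho> (u\<rho>) * g u\<close>, restricted to the simplices that come from edges of the component.
\<close>

section \<open>Hitting probabilities of a Markov chain\<close>

text \<open>
  The recursion conditions on the first step, whereas path measures are built by appending steps at
  the end. \<open>measure_chain_avoid\<close> below identifies this with the probability that the chain from \<open>x\<close>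
  is not at \<open>y\<close> at the times \<open>1, \<dots>, n\<close>.
\<close>

primrec avoid_prob :: "('a \<Rightarrow> 'a pmf) \<Rightarrow> 'a \<Rightarrow> nat \<Rightarrow> 'a \<Rightarrow> real" where
  "avoid_prob p y 0 x = 1"
| "avoid_prob p y (Suc n) x =
     measure_pmf.expectation (p x) (\<lambda>z. if z = y then 0 else avoid_prob p y n z)"

lemma integrable_pmf_bounded:
  fixes f :: "'a \<Rightarrow> real"
  assumes "\<And>x. \<bar>f x\<bar> \<le> B"
  shows "integrable (measure_pmf q) f"
  by (rule measure_pmf.integrable_const_bound[of _ B]) (use assms in auto)

lemma avoid_prob_bounds: "0 \<le> avoid_prob p y n x \<and> avoid_prob p y n x \<le> 1"
proof (induction n arbitrary: x)
  case (Suc n)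
  have "0 \<le> avoid_prob p y (Suc n) x"
    using Suc by (auto intro!: integral_nonneg_AE)
  moreover have "avoid_prob p y (Suc n) x \<le> 1"
    unfolding avoid_prob.simps
    by (rule measure_pmf.integral_le_const)
       (use Suc in \<open>auto intro!: integrable_pmf_bounded[of _ 1]\<close>)
  ultimately show ?case by simp
qed auto

lemma avoid_prob_integrable:
  "integrable (measure_pmf q) (\<lambda>z. if z = y then 0 else avoid_prob p y n z)"
  by (rule integrable_pmf_bounded[of _ 1]) (use avoid_prob_bounds[of p y n] in auto)

lemma avoid_prob_Suc_le: "avoid_prob p y (Suc n) x \<le> avoid_prob p y n x"
proof (induction n arbitrary: x)
  case 0
  show ?case using avoid_prob_bounds[of p y "Suc 0" x] by simp
next
  case (Suc n)
  show ?case
    unfolding avoid_prob.simps(2)[of p y n x] avoid_prob.simps(2)[of p y "Suc n" x]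
    by (rule integral_mono[OF avoid_prob_integrable avoid_prob_integrable])
       (use Suc in \<open>auto simp del: avoid_prob.simps\<close>)
qed

definition killed_step :: "('a \<Rightarrow> 'a pmf) \<Rightarrow> 'a \<Rightarrow> ('a \<Rightarrow> ennreal) \<Rightarrow> 'a \<Rightarrow> ennreal" where
  "killed_step p y \<phi> x = (\<integral>\<^sup>+z. (if z = y then 0 else \<phi> z) \<partial>measure_pmf (p x))"

lemma killed_step_iterate: "(killed_step p y ^^ n) (\<lambda>_. 1) x = ennreal (avoid_prob p y n x)"
proof (induction n arbitrary: x)
  case (Suc n)
  have "(killed_step p y ^^ Suc n) (\<lambda>_. 1) x
      = (\<integral>\<^sup>+z. ennreal (if z = y then 0 else avoid_prob p y n z) \<partial>measure_pmf (p x))"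
    unfolding funpow.simps o_apply killed_step_def[of p y _ x]
    by (rule nn_integral_cong) (simp add: Suc)
  also have "\<dots> = ennreal (avoid_prob p y (Suc n) x)"
    unfolding avoid_prob.simps
    by (rule nn_integral_eq_integral[OF avoid_prob_integrable])
       (use avoid_prob_bounds[of p y n] in auto)
  finally show ?case .
qed simp

text \<open>
  The expectation is taken over a general function \<open>\<phi>\<close> of the last state because the path measure is
  extended at its end: integrating out the last step replaces \<open>\<phi>\<close> by \<open>killed_step p y \<phi>\<close>, and the
  induction hypothesis must then apply to this new function.
\<close>

lemma nn_integral_chain_avoid:
  fixes p :: "'a \<Rightarrow> 'a pmf"
  shows "(\<integral>\<^sup>+Y. (if \<forall>k\<in>{1..n}. Y k \<noteq> y then \<phi> (Y n) else 0)
      \<partial>Ionescu_Tulcea.C (chain_step p x) (\<lambda>_. count_space UNIV) 0 (Suc n) (\<lambda>_. undefined))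
    = (killed_step p y ^^ n) \<phi> x"
proof (induction n arbitrary: \<phi>)
  interpret IT: Ionescu_Tulcea "chain_step p x" "\<lambda>_. count_space UNIV"
    by (rule Ionescu_Tulcea_chain_step)
  have space0: "(\<lambda>_. undefined) \<in> space (PiM {0..<0::nat} (\<lambda>_. count_space (UNIV::'a set)))"
    by (simp add: space_PiM)
  have meas1: "(\<lambda>Y. \<psi> (Y j)) \<in> borel_measurable (PiM {0..<Suc j} (\<lambda>_. count_space UNIV))"
    for j and \<psi> :: "'a \<Rightarrow> ennreal"
    by (rule measurable_compose[OF measurable_component_singleton]) auto
  have meas: "(\<lambda>Y. if \<forall>k\<in>{1..j}. Y k \<noteq> y then \<psi> (Y j) else (0::ennreal))
      \<in> borel_measurable (PiM {0..<Suc j} (\<lambda>_. count_space UNIV))" for j and \<psi> :: "'a \<Rightarrow> ennreal"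
  proof (rule measurable_If[OF meas1])
    show "{Y \<in> space (PiM {0..<Suc j} (\<lambda>_. count_space (UNIV::'a set))). \<forall>k\<in>{1..j}. Y k \<noteq> y}
        \<in> sets (PiM {0..<Suc j} (\<lambda>_. count_space UNIV))"
      by measurable
  qed simp
  {
    case 0
    have "IT.C 0 (Suc 0) (\<lambda>_. undefined) = IT.eP 0 (\<lambda>_. undefined)"
      unfolding IT.C.simps add_0 by (rule bind_return[OF IT.measurable_eP space0])
    then show ?case
      using IT.nn_integral_eP[OF space0 meas1[of \<phi> 0]]
      by (simp add: chain_step_def[of p x 0] nn_integral_return del: IT.C.simps)
  next
    case (Suc n)
    let ?f = "\<lambda>Y. if \<forall>k\<in>{1..Suc n}. Y k \<noteq> y then \<phi> (Y (Suc n)) else (0::ennreal)"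
    have "(\<integral>\<^sup>+Y. ?f Y \<partial>IT.C 0 (Suc (Suc n)) (\<lambda>_. undefined))
        = (\<integral>\<^sup>+Y. (\<integral>\<^sup>+Z. ?f Z \<partial>IT.eP (Suc n) Y) \<partial>IT.C 0 (Suc n) (\<lambda>_. undefined))"
    proof -
      have m: "IT.eP (Suc n) \<in> measurable (IT.C 0 (Suc n) (\<lambda>_. undefined))
          (subprob_algebra (PiM {0..<Suc (Suc n)} (\<lambda>_. count_space UNIV)))"
        using IT.measurable_eP[of "Suc n"]
        by (simp only: measurable_cong_sets[OF IT.sets_C[OF space0] refl]) simp
      show ?thesis
        unfolding IT.C.simps(2)[of 0 "Suc n"] add_0
        by (rule nn_integral_bind[OF meas m])
    qed
    also have "\<dots> = (\<integral>\<^sup>+Y. (if \<forall>k\<in>{1..n}. Y k \<noteq> y then killed_step p y \<phi> (Y n) else 0)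
        \<partial>IT.C 0 (Suc n) (\<lambda>_. undefined))"
    proof (rule nn_integral_cong)
      fix Y assume "Y \<in> space (IT.C 0 (Suc n) (\<lambda>_. undefined))"
      then have Y: "Y \<in> space (PiM {0..<Suc n} (\<lambda>_. count_space UNIV))"
        using IT.space_C[OF space0, of "Suc n"] by simp
      have "(\<integral>\<^sup>+Z. ?f Z \<partial>IT.eP (Suc n) Y)
          = (\<integral>\<^sup>+z. ?f (Y(Suc n := z)) \<partial>measure_pmf (p (Y n)))"
        using IT.nn_integral_eP[OF Y meas] by (simp add: chain_step_def[of p x "Suc n"])
      also have "\<dots> = (\<integral>\<^sup>+z. (if \<forall>k\<in>{1..n}. Y k \<noteq> y then (if z = y then 0 else \<phi> z) else 0)
          \<partial>measure_pmf (p (Y n)))"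
        by (rule nn_integral_cong) (auto simp: atLeastAtMostSuc_conv)
      finally show "(\<integral>\<^sup>+Z. ?f Z \<partial>IT.eP (Suc n) Y)
          = (if \<forall>k\<in>{1..n}. Y k \<noteq> y then killed_step p y \<phi> (Y n) else 0)"
        by (cases "\<forall>k\<in>{1..n}. Y k \<noteq> y") (simp_all only: killed_step_def if_True if_False, simp_all)
    qed
    also have "\<dots> = (killed_step p y ^^ n) (killed_step p y \<phi>) x"
      by (rule Suc)
    finally show ?case by (simp only: funpow_Suc_right o_apply)
  }
qed

lemma prob_space_chain_law: "prob_space (chain_law p x)"
  and sets_chain_law: "sets (chain_law p x) = sets (PiM UNIV (\<lambda>_. count_space UNIV))"
  and measure_chain_avoid:
    "measure (chain_law p x) {Y. \<forall>k\<in>{1..n}. Y k \<noteq> y} = avoid_prob p y n x"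
proof -
  interpret IT: Ionescu_Tulcea "chain_step p x" "\<lambda>_. count_space UNIV"
    by (rule Ionescu_Tulcea_chain_step)
  have space0: "(\<lambda>_. undefined) \<in> space (PiM {0..<0::nat} (\<lambda>_. count_space (UNIV::'a set)))"
    by (simp add: space_PiM)
  have law: "chain_law p x = IT.PF.lim" by (simp add: chain_law_def)
  show sets: "sets (chain_law p x) = sets (PiM UNIV (\<lambda>_. count_space UNIV))"
    unfolding law by simp
  have avoid: "emeasure (chain_law p x) {Y. \<forall>k\<in>{1..n}. Y k \<noteq> y} = ennreal (avoid_prob p y n x)" for n
  proof -
    let ?M = "\<lambda>J::nat set. PiM J (\<lambda>_. count_space (UNIV::'a set))"
    let ?J = "{0..<Suc n}"
    let ?A = "{Y \<in> space (?M ?J). \<forall>k\<in>{1..n}. Y k \<noteq> y}"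
    have A: "?A \<in> sets (?M ?J)" by measurable
    have emb: "{Y. \<forall>k\<in>{1..n}. Y k \<noteq> y} = IT.PF.emb UNIV ?J ?A"
      by (auto simp: prod_emb_def space_PiM PiE_iff)
    have emb2: "IT.PF.emb ?J ?J ?A = ?A"
      using sets.sets_into_space[OF A] by (auto simp: prod_emb_def space_PiM PiE_iff extensional_restrict)
    have setsC: "sets (IT.C 0 (Suc n) (\<lambda>_. undefined)) = sets (?M ?J)"
      using IT.sets_C[OF space0, of "Suc n"] by simp
    have "emeasure (chain_law p x) {Y. \<forall>k\<in>{1..n}. Y k \<noteq> y} = emeasure (IT.CI ?J) ?A"
      unfolding law emb by (rule IT.lim) (use A in auto)
    also have "\<dots> = emeasure (IT.C 0 (Suc n) (\<lambda>_. undefined)) ?A"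
      using IT.emeasure_CI[of ?J "Suc n" ?A] A emb2 by simp
    also have "\<dots> = (\<integral>\<^sup>+Y. indicator ?A Y \<partial>IT.C 0 (Suc n) (\<lambda>_. undefined))"
      by (rule nn_integral_indicator[symmetric]) (use A setsC in simp)
    also have "\<dots> = (\<integral>\<^sup>+Y. (if \<forall>k\<in>{1..n}. Y k \<noteq> y then 1 else 0) \<partial>IT.C 0 (Suc n) (\<lambda>_. undefined))"
      using sets_eq_imp_space_eq[OF setsC] by (intro nn_integral_cong) (auto split: split_indicator)
    also have "\<dots> = ennreal (avoid_prob p y n x)"
      using nn_integral_chain_avoid[where \<phi> = "\<lambda>_. 1"] 
      by (simp add: killed_step_iterate del: IT.C.simps)
    finally show ?thesis .
  qed
  show "measure (chain_law p x) {Y. \<forall>k\<in>{1..n}. Y k \<noteq> y} = avoid_prob p y n x"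
    using avoid[of n] avoid_prob_bounds[of p y n x] by (simp add: measure_def)
  have "space (chain_law p x) = UNIV"
    using sets_eq_imp_space_eq[OF sets] by (simp add: space_PiM)
  then show "prob_space (chain_law p x)"
    using avoid[of 0] by (intro prob_spaceI) simp
qed

text \<open>
  Continuity from above for the decreasing events that \<open>y\<close> is avoided up to time \<open>n\<close>. This turns
  recurrence into a statement about the recursively defined \<open>avoid_prob\<close>.
\<close>

lemma chain_hits_iff_avoid_prob_tendsto_0:
  "measure (chain_law p x) {Y. \<exists>k>0. Y k = y} = 1 \<longleftrightarrow> (\<lambda>n. avoid_prob p y n x) \<longlonglongrightarrow> 0"
proof -
  interpret prob_space "chain_law p x" by (rule prob_space_chain_law)
  have space: "space (chain_law p x) = UNIV"
    using sets_eq_imp_space_eq[OF sets_chain_law[of p x]] by (simp add: space_PiM)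
  have meas: "{Y. \<forall>k\<in>{1..n}. Y k \<noteq> y} \<in> sets (chain_law p x)" for n
  proof -
    have "{Y \<in> space (PiM UNIV (\<lambda>_. count_space UNIV)). \<forall>k\<in>{1..n}. Y k \<noteq> y}
        \<in> sets (PiM (UNIV::nat set) (\<lambda>_. count_space (UNIV::'a set)))"
      by measurable
    then show ?thesis by (simp add: sets_chain_law space_PiM)
  qed
  have "(\<lambda>n. measure (chain_law p x) {Y. \<forall>k\<in>{1..n}. Y k \<noteq> y})
      \<longlonglongrightarrow> measure (chain_law p x) (\<Inter>n. {Y. \<forall>k\<in>{1..n}. Y k \<noteq> y})"
    by (rule finite_Lim_measure_decseq) (use meas in \<open>auto simp: decseq_def\<close>)
  moreover have compl: "(\<Inter>n. {Y. \<forall>k\<in>{1..n::nat}. Y k \<noteq> y}) = UNIV - {Y. \<exists>k>0. Y k = y}"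
  proof (intro equalityI subsetI)
    fix Y :: "nat \<Rightarrow> 'a" assume "Y \<in> (\<Inter>n. {Y. \<forall>k\<in>{1..n}. Y k \<noteq> y})"
    then have "Y k \<noteq> y" if "k > 0" for k
      using that INT_D[OF \<open>Y \<in> _\<close>, of k] by (simp add: Suc_le_eq)
    then show "Y \<in> UNIV - {Y. \<exists>k>0. Y k = y}" by auto
  next
    fix Y :: "nat \<Rightarrow> 'a" assume "Y \<in> UNIV - {Y. \<exists>k>0. Y k = y}"
    then have "Y k \<noteq> y" if "k > 0" for k using that by blast
    then show "Y \<in> (\<Inter>n. {Y. \<forall>k\<in>{1..n}. Y k \<noteq> y})" by simp
  qed
  moreover have "measure (chain_law p x) (UNIV - {Y. \<exists>k>0. Y k = y})
      = 1 - measure (chain_law p x) {Y. \<exists>k>0. Y k = y}"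
  proof -
    have "UNIV - (\<Inter>n. {Y. \<forall>k\<in>{1..n}. Y k \<noteq> y}) \<in> sets (chain_law p x)"
      using sets.compl_sets[of "\<Inter>n. {Y. \<forall>k\<in>{1..n}. Y k \<noteq> y}" "chain_law p x"] meas space
      by (simp add: sets.countable_INT)
    then have "{Y. \<exists>k>0. Y k = y} \<in> sets (chain_law p x)"
      unfolding compl by (simp add: Diff_Diff_Int)
    then show ?thesis using prob_compl space by simp
  qed
  ultimately have lim: "(\<lambda>n. avoid_prob p y n x)
      \<longlonglongrightarrow> 1 - measure (chain_law p x) {Y. \<exists>k>0. Y k = y}"
    by (simp only: measure_chain_avoid)
  show ?thesis
  proof
    assume "(\<lambda>n. avoid_prob p y n x) \<longlonglongrightarrow> 0"
    from LIMSEQ_unique[OF lim this]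
    show "measure (chain_law p x) {Y. \<exists>k>0. Y k = y} = 1" by simp
  qed (use lim in simp)
qed

section \<open>Truncated Green functions\<close>

text \<open>
  The expected number of visits to \<open>v\<close> at the times \<open>0, \<dots>, N - 1\<close> of the chain started at \<open>u\<close>. Both
  transience and the energy estimates are expressed through this function.
\<close>

primrec green_trunc :: "('a \<Rightarrow> 'a pmf) \<Rightarrow> 'a \<Rightarrow> nat \<Rightarrow> 'a \<Rightarrow> real" where
  "green_trunc p v 0 u = 0"
| "green_trunc p v (Suc N) u =
     indicator {v} u + measure_pmf.expectation (p u) (green_trunc p v N)"

lemma green_trunc_bounds: "0 \<le> green_trunc p v N u \<and> green_trunc p v N u \<le> real N"
proof (induction N arbitrary: u)
  case (Suc N)
  have "measure_pmf.expectation (p u) (green_trunc p v N) \<le> real N"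
    by (rule measure_pmf.integral_le_const)
       (use Suc in \<open>auto intro!: integrable_pmf_bounded[of _ "real N"]\<close>)
  moreover have "0 \<le> measure_pmf.expectation (p u) (green_trunc p v N)"
    using Suc by (auto intro!: integral_nonneg_AE)
  ultimately show ?case by (auto split: split_indicator)
qed simp

lemma green_trunc_integrable: "integrable (measure_pmf q) (green_trunc p v N)"
  by (rule integrable_pmf_bounded[of _ "real N"]) (use green_trunc_bounds[of p v N] in auto)

lemma green_trunc_le_Suc: "green_trunc p v N u \<le> green_trunc p v (Suc N) u"
proof (induction N arbitrary: u)
  case 0
  show ?case by simp
next
  case (Suc N)
  have "measure_pmf.expectation (p u) (green_trunc p v N)
      \<le> measure_pmf.expectation (p u) (green_trunc p v (Suc N))"
    by (rule integral_mono[OF green_trunc_integrable green_trunc_integrable]) (use Suc in blast)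
  then show ?case
    unfolding green_trunc.simps(2)[of p v N u] green_trunc.simps(2)[of p v "Suc N" u] by simp
qed

lemma green_trunc_superharmonic:
  "green_trunc p v N u - measure_pmf.expectation (p u) (green_trunc p v N) \<le> indicator {v} u"
  using green_trunc_le_Suc[of p v N u] by simp

text \<open>
  Maximum principle: the chain collects no visits before it first reaches \<open>v\<close>, and afterwards it has at
  most \<open>N\<close> time steps left. Boundedness at \<open>v\<close> is therefore boundedness everywhere.
\<close>

lemma green_trunc_le_diagonal: "green_trunc p v N u \<le> green_trunc p v N v"
proof (induction N arbitrary: u)
  case (Suc N)
  show ?case
  proof (cases "u = v")
    case False
    have "measure_pmf.expectation (p u) (green_trunc p v N) \<le> green_trunc p v N v"
      by (rule measure_pmf.integral_le_const[OF green_trunc_integrable]) (use Suc in auto)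
    then have "green_trunc p v (Suc N) u \<le> green_trunc p v N v" using False by simp
    then show ?thesis using green_trunc_le_Suc[of p v N v] by linarith
  qed simp
qed simp

lemma green_function_exists:
  assumes bound: "\<And>N. green_trunc p v N v \<le> B"
  obtains g where "\<And>u. (\<lambda>N. green_trunc p v N u) \<longlonglongrightarrow> g u"
    and "\<And>u. 0 \<le> g u" and "\<And>u. g u \<le> B"
    and "\<And>u. g u = indicator {v} u + measure_pmf.expectation (p u) g"
proof -
  have le: "green_trunc p v N u \<le> B" for N u
    using green_trunc_le_diagonal[of p v N u] bound[of N] by linarith
  have "\<exists>l. (\<lambda>N. green_trunc p v N u) \<longlonglongrightarrow> l" for u
  proof -
    have "incseq (\<lambda>N. green_trunc p v N u)"
      by (rule incseq_SucI) (rule green_trunc_le_Suc)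
    then show ?thesis using le by (metis incseq_convergent)
  qed
  then obtain g where g: "\<And>u. (\<lambda>N. green_trunc p v N u) \<longlonglongrightarrow> g u" by metis
  have "(\<lambda>N. measure_pmf.expectation (p u) (green_trunc p v N))
      \<longlonglongrightarrow> measure_pmf.expectation (p u) g" for u
    by (rule integral_dominated_convergence[where w = "\<lambda>_. B"])
       (use g le green_trunc_bounds[of p v] in \<open>auto simp: abs_of_nonneg\<close>)
  then have "(\<lambda>N. green_trunc p v (Suc N) u)
      \<longlonglongrightarrow> indicator {v} u + measure_pmf.expectation (p u) g" for u
    unfolding green_trunc.simps by (intro tendsto_intros)
  then have "g u = indicator {v} u + measure_pmf.expectation (p u) g" for u
    using LIMSEQ_unique[OF LIMSEQ_Suc[OF g[of u]]] by blast
  moreover have "0 \<le> g u" "g u \<le> B" for u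
    using LIMSEQ_le_const[OF g[of u], of 0] LIMSEQ_le_const2[OF g[of u], of B]
      green_trunc_bounds[of p v _ u] le by blast+
  ultimately show thesis using g that by blast
qed

text \<open>
  Suppose the limit \<open>g\<close> exists. Unfolding \<open>g = 1\<^sub>v + P g\<close> along the chain until \<open>v\<close> is reached shows that
  \<open>P g u\<close> is at least \<open>g v\<close> times the probability to reach \<open>v\<close> at a positive time. With certain return this
  gives \<open>P g v \<ge> g v\<close>, contradicting \<open>g v = 1 + P g v\<close>.
\<close>

lemma green_unbounded_if_returns:
  assumes returns: "(\<lambda>n. avoid_prob p v n v) \<longlonglongrightarrow> 0"
  shows "\<not> (\<forall>N. green_trunc p v N v \<le> B)"
proof
  assume "\<forall>N. green_trunc p v N v \<le> B"
  then obtain g where g0: "\<And>u. 0 \<le> g u" and gB: "\<And>u. g u \<le> B"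
    and g: "\<And>u. g u = indicator {v} u + measure_pmf.expectation (p u) g"
    using green_function_exists[of p v B] by metis
  have int_g: "integrable (measure_pmf q) g" for q
    by (rule integrable_pmf_bounded[of _ B]) (use g0 gB in \<open>simp add: abs_of_nonneg\<close>)
  have minorant: "g v * (1 - avoid_prob p v n u) \<le> measure_pmf.expectation (p u) g" for n u
  proof (induction n arbitrary: u)
    case 0
    show ?case using g0 by (auto intro!: integral_nonneg_AE)
  next
    case (Suc n)
    let ?h = "\<lambda>z. if z = v then 0 else avoid_prob p v n z"
    have "g v * (1 - avoid_prob p v (Suc n) u)
        = measure_pmf.expectation (p u) (\<lambda>z. g v * (1 - ?h z))"
      using avoid_prob_integrable[of "p u" v p n] by simp
    also have "\<dots> \<le> measure_pmf.expectation (p u) g"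
    proof (rule integral_mono)
      show "integrable (measure_pmf (p u)) (\<lambda>z. g v * (1 - ?h z))"
        using avoid_prob_integrable[of "p u" v p n] by simp
      show "g v * (1 - ?h z) \<le> g z" for z
        using Suc[of z] g[of z] by (cases "z = v") auto
    qed (rule int_g)
    finally show ?case .
  qed
  have "(\<lambda>n. g v * (1 - avoid_prob p v n v)) \<longlonglongrightarrow> g v * (1 - 0)"
    by (intro tendsto_intros returns)
  then have "g v * (1 - 0) \<le> measure_pmf.expectation (p v) g"
    by (rule LIMSEQ_le_const2) (use minorant in auto)
  then show False using g[of v] by simp
qed

text \<open>
  Existence of such a function is the form of transience that passes most easily from one vertex to
  another. The upper bound \<open>1\<close> is a normalisation that makes integrability automatic.
\<close>

definition strictly_superharmonic_at :: "('a \<Rightarrow> 'a pmf) \<Rightarrow> 'a \<Rightarrow> ('a \<Rightarrow> real) \<Rightarrow> bool" where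
  "strictly_superharmonic_at p v s \<longleftrightarrow> (\<forall>u. 0 \<le> s u \<and> s u \<le> 1 \<and> measure_pmf.expectation (p u) s \<le> s u) \<and>
     measure_pmf.expectation (p v) s < s v"

text \<open>
  By induction on \<open>N\<close>, \<open>s\<close> dominates \<open>s v - P s v\<close> times the truncated Green function, since
  \<open>s - P s\<close> dominates \<open>s v - P s v\<close> times \<open>1\<^sub>v\<close>.
\<close>

lemma green_bounded_if_strictly_superharmonic:
  assumes s: "strictly_superharmonic_at p v s"
  shows "\<exists>B. \<forall>N. green_trunc p v N v \<le> B"
proof -
  let ?c = "s v - measure_pmf.expectation (p v) s"
  have c: "0 < ?c" and s0: "\<And>u. 0 \<le> s u" and s1: "\<And>u. s u \<le> 1"
    and sup: "\<And>u. measure_pmf.expectation (p u) s \<le> s u"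
    using s by (auto simp: strictly_superharmonic_at_def)
  have int_s: "integrable (measure_pmf q) s" for q
    by (rule integrable_pmf_bounded[of _ 1]) (use s0 s1 in \<open>simp add: abs_of_nonneg\<close>)
  have "?c * green_trunc p v N u \<le> s u" for N u
  proof (induction N arbitrary: u)
    case (Suc N)
    have "?c * green_trunc p v (Suc N) u
        = ?c * indicator {v} u + measure_pmf.expectation (p u) (\<lambda>z. ?c * green_trunc p v N z)"
      by (simp add: distrib_left)
    also have "measure_pmf.expectation (p u) (\<lambda>z. ?c * green_trunc p v N z)
        \<le> measure_pmf.expectation (p u) s"
      by (rule integral_mono) (use Suc int_s green_trunc_integrable[of "p u" p v N] in auto)
    also have "?c * indicator {v} u + measure_pmf.expectation (p u) s \<le> s u"
      using sup[of u] by (auto split: split_indicator)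
    finally show ?case by simp
  qed (use s0 in simp)
  then have "green_trunc p v N v \<le> s v / ?c" for N
    using c by (simp add: pos_le_divide_eq mult.commute)
  then show ?thesis by blast
qed

text \<open>
  Averaging moves the defect: \<open>P s - P (P s) = P (s - P s)\<close> is positive at every vertex that can step
  to \<open>w\<close>.
\<close>

lemma strictly_superharmonic_at_predecessor:
  assumes s: "strictly_superharmonic_at p w s" and step: "0 < pmf (p v) w"
  shows "strictly_superharmonic_at p v (\<lambda>u. measure_pmf.expectation (p u) s)"
proof -
  have s0: "\<And>u. 0 \<le> s u" and s1: "\<And>u. s u \<le> 1"
    and sup: "\<And>u. measure_pmf.expectation (p u) s \<le> s u"
    and pos: "measure_pmf.expectation (p w) s < s w"
    using s by (auto simp: strictly_superharmonic_at_def)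
  let ?s = "\<lambda>u. measure_pmf.expectation (p u) s"
  have int_s: "integrable (measure_pmf q) s" for q
    by (rule integrable_pmf_bounded[of _ 1]) (use s0 s1 in \<open>simp add: abs_of_nonneg\<close>)
  have bounds: "0 \<le> ?s u" "?s u \<le> 1" for u
    using s0 sup[of u] s1[of u] by (auto intro!: integral_nonneg_AE intro: order_trans)
  have int_Ps: "integrable (measure_pmf q) ?s" for q
    by (rule integrable_pmf_bounded[of _ 1]) (use bounds in \<open>simp add: abs_of_nonneg\<close>)
  have "measure_pmf.expectation (p v) ?s < ?s v"
  proof -
    have "measure_pmf.expectation (p v) (\<lambda>z. s z - ?s z) \<noteq> 0"
    proof
      assume "measure_pmf.expectation (p v) (\<lambda>z. s z - ?s z) = 0"
      then have "AE z in measure_pmf (p v). s z - ?s z = 0"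
        using sup int_s int_Ps by (subst (asm) integral_nonneg_eq_0_iff_AE) auto
      then show False using step pos by (auto simp: AE_measure_pmf_iff set_pmf_iff)
    qed
    moreover have "0 \<le> measure_pmf.expectation (p v) (\<lambda>z. s z - ?s z)"
      using sup by (auto intro!: integral_nonneg_AE)
    ultimately show ?thesis using int_s int_Ps by simp
  qed
  moreover have "measure_pmf.expectation (p u) ?s \<le> ?s u" for u
    by (rule integral_mono[OF int_Ps int_s]) (rule sup)
  ultimately show ?thesis using bounds by (simp add: strictly_superharmonic_at_def)
qed

text \<open>
  Let \<open>h u\<close> be the probability to avoid \<open>y\<close> at all positive times from \<open>u\<close>, and \<open>s = 1 - h\<close> off \<open>y\<close>,
  \<open>s y = 1\<close>, the probability to visit \<open>y\<close> at some time, including time zero. Then \<open>P s = 1 - h\<close>, so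
  \<open>s - P s = h y\<close> at \<open>y\<close> and \<open>0\<close> elsewhere. If \<open>h y\<close> were \<open>0\<close>, then \<open>h\<close>, being harmonic for the chain killed
  at \<open>y\<close>, would vanish along every path from \<open>y\<close>, in particular at \<open>x\<close>.
\<close>

lemma strictly_superharmonic_if_not_hitting:
  assumes path: "(\<lambda>u w. 0 < pmf (p u) w)\<^sup>*\<^sup>* y x"
    and miss: "\<not> (\<lambda>n. avoid_prob p y n x) \<longlonglongrightarrow> 0"
  shows "\<exists>s. strictly_superharmonic_at p y s"
proof -
  have "\<exists>l. (\<lambda>n. avoid_prob p y n u) \<longlonglongrightarrow> l" for u
  proof -
    have "decseq (\<lambda>n. avoid_prob p y n u)"
      by (rule decseq_SucI) (rule avoid_prob_Suc_le)
    then show ?thesis using avoid_prob_bounds[of p y _ u] by (metis decseq_convergent)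
  qed
  then obtain h where h: "\<And>u. (\<lambda>n. avoid_prob p y n u) \<longlonglongrightarrow> h u" by metis
  have h0: "0 \<le> h u" and h1: "h u \<le> 1" for u
    using LIMSEQ_le_const[OF h[of u], of 0] LIMSEQ_le_const2[OF h[of u], of 1]
      avoid_prob_bounds[of p y _ u] by blast+
  let ?k = "\<lambda>z. if z = y then 0 else h z"
  have int_k: "integrable (measure_pmf q) ?k" for q
    by (rule integrable_pmf_bounded[of _ 1]) (use h0 h1 in \<open>simp add: abs_of_nonneg\<close>)
  have "(\<lambda>n. avoid_prob p y (Suc n) u) \<longlonglongrightarrow> measure_pmf.expectation (p u) ?k" for u
    unfolding avoid_prob.simps
    by (rule integral_dominated_convergence[where w = "\<lambda>_. 1"])
       (use h avoid_prob_bounds[of p y] in \<open>auto simp: abs_of_nonneg\<close>)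
  then have h_eq: "h u = measure_pmf.expectation (p u) ?k" for u
    using LIMSEQ_unique[OF LIMSEQ_Suc[OF h[of u]]] by blast
  have "h y \<noteq> 0"
  proof
    assume hy: "h y = 0"
    from path have "h x = 0"
    proof induction
      case (step u w)
      have "measure_pmf.expectation (p u) ?k = 0" using h_eq[of u] step.IH by simp
      then have "AE z in measure_pmf (p u). ?k z = 0"
        using h0 by (subst (asm) integral_nonneg_eq_0_iff_AE[OF int_k]) auto
      then show ?case using step.hyps hy by (auto simp: AE_measure_pmf_iff set_pmf_iff split: if_splits)
    qed (rule hy)
    then show False using h[of x] miss by simp
  qed
  have "strictly_superharmonic_at p y (\<lambda>z. 1 - ?k z)"
    unfolding strictly_superharmonic_at_def
    using int_k h0 h1 h_eq \<open>h y \<noteq> 0\<close> by (auto simp: order_le_less)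
  then show ?thesis by blast
qed

text \<open>
  Transience at the pair \<open>(x, y)\<close> yields a strictly superharmonic function at \<open>y\<close>, which is carried
  backwards along a path from \<open>v\<close> to \<open>y\<close>.
\<close>

lemma green_bounded_if_not_hitting:
  assumes "(\<lambda>u w. 0 < pmf (p u) w)\<^sup>*\<^sup>* y x" and "(\<lambda>u w. 0 < pmf (p u) w)\<^sup>*\<^sup>* v y"
    and "\<not> (\<lambda>n. avoid_prob p y n x) \<longlonglongrightarrow> 0"
  shows "\<exists>B. \<forall>N. green_trunc p v N v \<le> B"
proof -
  have "\<exists>s. strictly_superharmonic_at p v s"
    using assms(2)
  proof (induction rule: converse_rtranclp_induct)
    case base
    show ?case using assms strictly_superharmonic_if_not_hitting[of p y x] by blast
  qed (blast intro: strictly_superharmonic_at_predecessor)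
  then show ?thesis using green_bounded_if_strictly_superharmonic by metis
qed

section \<open>Energy and flows on weighted graphs\<close>

lemma has_sum_pmf_expectation:
  fixes f :: "'a \<Rightarrow> real"
  assumes bound: "\<And>x. \<bar>f x\<bar> \<le> B"
  shows "((\<lambda>x. pmf q x * f x) has_sum measure_pmf.expectation q f) UNIV"
proof -
  have "Infinite_Set_Sum.abs_summable_on (\<lambda>x. pmf q x * f x) UNIV"
  proof -
    have "Infinite_Set_Sum.abs_summable_on (\<lambda>x. B * pmf q x) UNIV"
      by (simp add: abs_summable_on_def integrable_pmf)
    then have "(\<lambda>x. norm (B * pmf q x)) summable_on UNIV"
      by (simp only: abs_summable_equivalent)
    then have "(\<lambda>x. norm (pmf q x * f x)) summable_on UNIV"
    proof (rule Infinite_Sum.abs_summable_on_comparison_test)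
      show "norm (pmf q x * f x) \<le> norm (B * pmf q x)" for x
        using bound[of x] mult_left_mono[of "\<bar>f x\<bar>" "\<bar>B\<bar>" "pmf q x"] by (auto simp: abs_mult mult.commute)
    qed
    then show ?thesis by (simp only: abs_summable_equivalent)
  qed
  then show ?thesis
    unfolding pmf_expectation_eq_infsetsum
    by (metis abs_summable_equivalent abs_summable_summable has_sum_infsum infsetsum_infsum)
qed

lemma has_sum_at_point:
  fixes f :: "'a \<Rightarrow> 'b::{comm_monoid_add, topological_space}"
  assumes "v \<in> A" and "\<And>x. x \<in> A \<Longrightarrow> x \<noteq> v \<Longrightarrow> f x = 0"
  shows "(f has_sum f v) A"
  by (rule has_sum_finite_neutralI[of "{v}"]) (use assms in auto)

locale weighted_graph =
  fixes V :: "'a set" and b :: "'a \<Rightarrow> 'a \<Rightarrow> real"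
  assumes nonneg: "u \<in> V \<Longrightarrow> w \<in> V \<Longrightarrow> 0 \<le> b u w"
    and symmetric: "u \<in> V \<Longrightarrow> w \<in> V \<Longrightarrow> b u w = b w u"
    and summable: "u \<in> V \<Longrightarrow> b u summable_on V"
begin

definition deg :: "'a \<Rightarrow> real" where "deg u = (\<Sum>\<^sub>\<infinity>w\<in>V. b u w)"

lemma has_sum_deg: "u \<in> V \<Longrightarrow> (b u has_sum deg u) V"
  unfolding deg_def by (rule has_sum_infsum) (rule summable)

lemma deg_nonneg: "u \<in> V \<Longrightarrow> 0 \<le> deg u"
  unfolding deg_def by (rule infsum_nonneg) (rule nonneg)

lemma deg_pos_if_edge:
  assumes "u \<in> V" "w \<in> V" "0 < b u w"
  shows "0 < deg u"
proof -
  have "b u w \<le> deg u"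
    using finite_sum_le_has_sum[OF has_sum_deg[OF assms(1)], of "{w}"] assms nonneg by auto
  then show ?thesis using assms(3) by simp
qed

lemma pmf_graph_step:
  assumes u: "u \<in> V" and pos: "0 < deg u"
  shows "pmf (graph_step V b u) w = (if w \<in> V then b u w / deg u else 0)"
proof -
  let ?q = "\<lambda>w. if w \<in> V then b u w / deg u else 0"
  have q0: "0 \<le> ?q w" for w using nonneg[OF u] pos by auto
  have "((\<lambda>w. b u w / deg u) has_sum (deg u / deg u)) V"
    by (rule has_sum_divide_const) (rule has_sum_deg[OF u])
  then have "((\<lambda>w. b u w / deg u) has_sum 1) V" using pos by simp
  then have q: "(?q has_sum 1) UNIV"
    by (rule has_sum_cong_neutral[THEN iffD1, rotated -1]) auto
  have "Infinite_Set_Sum.abs_summable_on ?q UNIV"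
    using has_sum_imp_summable[OF q] q0 by (simp flip: abs_summable_equivalent)
  then have "(\<integral>\<^sup>+w. ennreal (?q w) \<partial>count_space UNIV) = ennreal (infsum ?q UNIV)"
    using q0 by (subst nn_integral_conv_infsetsum) (auto simp only: infsetsum_infsum)
  then have "(\<integral>\<^sup>+w. ennreal (?q w) \<partial>count_space UNIV) = 1"
    using infsumI[OF q] by simp
  then show ?thesis
    unfolding graph_step_def deg_def[symmetric] using q0 by (subst pmf_embed_pmf) auto
qed

text \<open>
  This turns expectations under the walk into sums over the edges, which can be interchanged.
\<close>

lemma has_sum_step_expectation:
  fixes f :: "'a \<Rightarrow> real"
  assumes u: "u \<in> V" and pos: "0 < deg u" and bound: "\<And>x. \<bar>f x\<bar> \<le> B"
  shows "((\<lambda>w. b u w * f w) has_sum deg u * measure_pmf.expectation (graph_step V b u) f) V"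
proof -
  let ?p = "graph_step V b u"
  have "((\<lambda>w. pmf ?p w * f w) has_sum measure_pmf.expectation ?p f) UNIV"
    by (rule has_sum_pmf_expectation[OF bound])
  then have "((\<lambda>w. b u w / deg u * f w) has_sum measure_pmf.expectation ?p f) V"
    by (rule has_sum_cong_neutral[THEN iffD1, rotated -1]) (auto simp: pmf_graph_step[OF u pos])
  from has_sum_cmult_right[OF this, of "deg u"] show ?thesis
    using pos by simp
qed

lemma has_sum_rows:
  assumes f: "\<And>u. u \<in> V \<Longrightarrow> 0 \<le> f u" and S: "((\<lambda>u. deg u * f u) has_sum S) V"
  shows "((\<lambda>(u, w). b u w * f u) has_sum S) (V \<times> V)"
proof (rule has_sum_SigmaI[OF _ S])
  show rows: "((\<lambda>w. case (u, w) of (u, w) \<Rightarrow> b u w * f u) has_sum deg u * f u) V" if "u \<in> V" for u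
    using has_sum_cmult_left[OF has_sum_deg[OF that], of "f u"] by simp
  show "(\<lambda>(u, w). b u w * f u) summable_on V \<times> V"
    by (rule summable_on_SigmaI[OF rows has_sum_imp_summable[OF S]]) (use f nonneg in auto)
qed

text \<open>
  Together with the previous lemma: the degree measure is invariant under the walk, by symmetry of
  the weights.
\<close>

lemma has_sum_columns:
  assumes f: "\<And>u. u \<in> V \<Longrightarrow> 0 \<le> f u" and S: "((\<lambda>u. deg u * f u) has_sum S) V"
  shows "((\<lambda>(u, w). b u w * f w) has_sum S) (V \<times> V)"
proof -
  have "((\<lambda>(u, w). b u w * f u) has_sum S) (V \<times> V)"
    by (rule has_sum_rows[OF f S])
  then have "((\<lambda>(u, w). b w u * f w) has_sum S) (V \<times> V)"
    by (subst (asm) has_sum_swap) simp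
  then show ?thesis
    by (rule has_sum_cong[THEN iffD1, rotated]) (auto simp: symmetric)
qed

end

text \<open>
  At a vertex of degree zero the quotients defining \<open>graph_step\<close> do not sum to one, so the walk needs positive
  degrees.
\<close>

locale weighted_graph_walk = weighted_graph +
  assumes deg_pos: "u \<in> V \<Longrightarrow> 0 < deg u"
begin

abbreviation "step \<equiv> graph_step V b"

lemma deg_summable_green_trunc:
  assumes v: "v \<in> V"
  shows "(\<lambda>u. deg u * green_trunc step v N u) summable_on V"
proof (induction N)
  case (Suc N)
  then obtain S where S: "((\<lambda>u. deg u * green_trunc step v N u) has_sum S) V"
    by (auto simp: summable_on_def)
  have "((\<lambda>u. deg u * measure_pmf.expectation (step u) (green_trunc step v N)) has_sum S) V"
  proof (rule has_sum_SigmaD[OF has_sum_columns[OF _ S]])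
    show "((\<lambda>w. case (u, w) of (u, w) \<Rightarrow> b u w * green_trunc step v N w)
        has_sum deg u * measure_pmf.expectation (step u) (green_trunc step v N)) V"
      if "u \<in> V" for u
      using has_sum_step_expectation[OF that deg_pos[OF that], of "green_trunc step v N" "real N"]
        green_trunc_bounds[of step v N] by simp
  qed (simp add: green_trunc_bounds)
  moreover have "(\<lambda>u. deg u * indicator {v} u) summable_on V"
    by (rule has_sum_imp_summable, rule has_sum_at_point[OF v]) simp
  ultimately show ?case
    by (simp add: distrib_left summable_on_add has_sum_imp_summable)
qed simp

text \<open>
  Expanding the square turns the energy into \<open>2 * (\<Sum>u. deg u * f u * (f u - P f u))\<close>. Summability of
  \<open>deg u * f u\<close> replaces the finite support that is customary here and would be lost after one step on
  a graph that is not locally finite.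
\<close>

lemma energy_le_deg_times_value:
  fixes f :: "'a \<Rightarrow> real"
  assumes v: "v \<in> V" and f: "\<And>u. 0 \<le> f u" "\<And>u. f u \<le> B"
    and sup: "\<And>u. u \<in> V \<Longrightarrow> f u - measure_pmf.expectation (step u) f \<le> indicator {v} u"
    and sumf: "(\<lambda>u. deg u * f u) summable_on V"
  obtains E where "((\<lambda>(u, w). b u w * (f u - f w)\<^sup>2) has_sum E) (V \<times> V)" and "E \<le> 2 * deg v * f v"
proof -
  have Pf: "((\<lambda>w. b u w * f w) has_sum deg u * measure_pmf.expectation (step u) f) V" if "u \<in> V" for u
    by (rule has_sum_step_expectation[OF that deg_pos[OF that], of _ B]) (use f in \<open>simp add: abs_of_nonneg\<close>)
  have "(\<lambda>u. deg u * (f u)\<^sup>2) summable_on V"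
  proof (rule summable_on_comparison_test)
    show "(\<lambda>u. B * (deg u * f u)) summable_on V" by (rule summable_on_cmult_right[OF sumf])
    show "deg u * (f u)\<^sup>2 \<le> B * (deg u * f u)" if "u \<in> V" for u
    proof -
      have "deg u * f u * f u \<le> deg u * f u * B"
        using f deg_nonneg[OF that] by (intro mult_left_mono) auto
      then show ?thesis by (simp add: power2_eq_square algebra_simps)
    qed
  qed (use deg_nonneg in auto)
  then obtain S where S: "((\<lambda>u. deg u * (f u)\<^sup>2) has_sum S) V" by (auto simp: summable_on_def)
  have rows: "((\<lambda>(u, w). b u w * (f u)\<^sup>2) has_sum S) (V \<times> V)"
    by (rule has_sum_rows[OF _ S]) simp
  have columns: "((\<lambda>(u, w). b u w * (f w)\<^sup>2) has_sum S) (V \<times> V)"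
    by (rule has_sum_columns[OF _ S]) simp
  have "(\<lambda>(u, w). b u w * f u * f w) summable_on (V \<times> V)"
  proof (rule summable_on_comparison_test)
    show "(\<lambda>z. (\<lambda>(u, w). b u w * (f u)\<^sup>2) z + (\<lambda>(u, w). b u w * (f w)\<^sup>2) z) summable_on (V \<times> V)"
      using rows columns by (intro summable_on_add) (auto simp: summable_on_def)
    show "(\<lambda>(u, w). b u w * f u * f w) z
        \<le> (\<lambda>(u, w). b u w * (f u)\<^sup>2) z + (\<lambda>(u, w). b u w * (f w)\<^sup>2) z" if z: "z \<in> V \<times> V" for z
    proof -
      obtain u w where uw: "z = (u, w)" by (cases z)
      have "f u * f w \<le> (f u)\<^sup>2 + (f w)\<^sup>2"
        using sum_squares_bound[of "f u" "f w"] f[of u] f[of w] mult_nonneg_nonneg[of "f u" "f w"] by linarith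
      then have "b u w * (f u * f w) \<le> b u w * ((f u)\<^sup>2 + (f w)\<^sup>2)"
        using z uw nonneg by (intro mult_left_mono) auto
      then show ?thesis using uw by (simp add: algebra_simps)
    qed
  qed (use f nonneg in auto)
  then obtain T where T: "((\<lambda>(u, w). b u w * f u * f w) has_sum T) (V \<times> V)"
    by (auto simp: summable_on_def)
  have T': "((\<lambda>u. f u * (deg u * measure_pmf.expectation (step u) f)) has_sum T) V"
  proof (rule has_sum_SigmaD[OF T])
    show "((\<lambda>w. case (u, w) of (u, w) \<Rightarrow> b u w * f u * f w)
        has_sum f u * (deg u * measure_pmf.expectation (step u) f)) V" if "u \<in> V" for u
      using has_sum_cmult_right[OF Pf[OF that], of "f u"] by (simp add: mult_ac)
  qed
  have "((\<lambda>z. (\<lambda>(u, w). b u w * (f u)\<^sup>2) z + (\<lambda>(u, w). b u w * (f w)\<^sup>2) z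
      + (- 2) * (\<lambda>(u, w). b u w * f u * f w) z) has_sum S + S + (- 2) * T) (V \<times> V)"
    by (intro has_sum_add has_sum_cmult_right rows columns T)
  then have E: "((\<lambda>(u, w). b u w * (f u - f w)\<^sup>2) has_sum S + S + (- 2) * T) (V \<times> V)"
    by (rule has_sum_cong[THEN iffD1, rotated]) (auto simp: power2_eq_square algebra_simps)
  have "((\<lambda>u. deg u * (f u)\<^sup>2 + (- 1) * (f u * (deg u * measure_pmf.expectation (step u) f)))
      has_sum S + (- 1) * T) V"
    by (intro has_sum_add has_sum_cmult_right S T')
  moreover have "((\<lambda>u. deg u * f u * indicator {v} u) has_sum deg v * f v * indicator {v} v) V"
    by (rule has_sum_at_point[OF v]) simp
  ultimately have "S + (- 1) * T \<le> deg v * f v * indicator {v} v"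
  proof (rule has_sum_mono)
    fix u assume u: "u \<in> V"
    have "deg u * f u * (f u - measure_pmf.expectation (step u) f) \<le> deg u * f u * indicator {v} u"
      using sup[OF u] f deg_nonneg[OF u] by (intro mult_left_mono) auto
    then show "deg u * (f u)\<^sup>2 + (- 1) * (f u * (deg u * measure_pmf.expectation (step u) f))
        \<le> deg u * f u * indicator {v} u"
      by (simp add: power2_eq_square algebra_simps)
  qed
  then show thesis by (intro that[OF E]) simp
qed

lemma green_trunc_energy:
  assumes v: "v \<in> V"
  obtains E where "((\<lambda>(u, w). b u w * (green_trunc step v N u - green_trunc step v N w)\<^sup>2) has_sum E) (V \<times> V)"
    and "E \<le> 2 * deg v * green_trunc step v N v"
  by (rule energy_le_deg_times_value[OF v, of "green_trunc step v N" "real N"])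
     (use green_trunc_bounds[of step v N] deg_summable_green_trunc[OF v, of N]
       green_trunc_superharmonic[of step v N] in auto)

text \<open>
  Pair the flow with the gradient of \<open>f = g\<^sub>N\<close>. By antisymmetry
  \<open>2 * f v * s = (\<Sum>(u, w). (f u - f w) * b u w * A u w)\<close>; bounding the right side by
  \<open>t / 2\<close> times the energy of \<open>f\<close> plus \<open>W / (2 * t)\<close>, and the energy by \<open>2 * deg v * f v\<close>, leaves a bound
  on \<open>f v\<close> for a suitable \<open>t\<close>.
\<close>

lemma flow_bounds_green_trunc:
  fixes A :: "'a \<Rightarrow> 'a \<Rightarrow> complex"
  assumes v: "v \<in> V" and anti: "\<And>u w. u \<in> V \<Longrightarrow> w \<in> V \<Longrightarrow> b u w * A w u = - (b u w * A u w)"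
    and W: "((\<lambda>(u, w). b u w * (cmod (A u w))\<^sup>2) has_sum W) (V \<times> V)"
    and div: "\<And>u. u \<in> V \<Longrightarrow> ((\<lambda>w. b u w * A u w) has_sum s * indicator {v} u) V"
  shows "2 * (cmod s)\<^sup>2 * green_trunc step v N v \<le> deg v * W"
proof (cases "s = 0")
  case True
  have "0 \<le> W" by (rule has_sum_nonneg[OF W]) (use nonneg in auto)
  then show ?thesis using True deg_nonneg[OF v] by simp
next
  case False
  let ?f = "green_trunc step v N"
  have f0: "0 \<le> ?f u" for u using green_trunc_bounds[of step v N u] by simp
  obtain E where E: "((\<lambda>(u, w). b u w * (?f u - ?f w)\<^sup>2) has_sum E) (V \<times> V)"
    and E_le: "E \<le> 2 * deg v * ?f v"
    by (rule green_trunc_energy[OF v])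
  let ?F = "\<lambda>(u, w). of_real (?f u) * (b u w * A u w)"
  have "(\<lambda>u. deg u * (?f u)\<^sup>2) summable_on V"
  proof (rule summable_on_comparison_test)
    show "(\<lambda>u. real N * (deg u * ?f u)) summable_on V"
      by (rule summable_on_cmult_right[OF deg_summable_green_trunc[OF v]])
    show "deg u * (?f u)\<^sup>2 \<le> real N * (deg u * ?f u)" if "u \<in> V" for u
    proof -
      have "deg u * ?f u * ?f u \<le> deg u * ?f u * real N"
        using green_trunc_bounds[of step v N u] deg_nonneg[OF that] by (intro mult_left_mono) auto
      then show ?thesis by (simp add: power2_eq_square algebra_simps)
    qed
  qed (use deg_nonneg in auto)
  then obtain S where "((\<lambda>u. deg u * (?f u)\<^sup>2) has_sum S) V" by (auto simp: summable_on_def)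
  then have rows: "((\<lambda>(u, w). b u w * (?f u)\<^sup>2) has_sum S) (V \<times> V)"
    by (rule has_sum_rows[rotated]) simp
  have "(\<lambda>z. norm (?F z)) summable_on (V \<times> V)"
  proof (rule Infinite_Sum.abs_summable_on_comparison_test')
    show "(\<lambda>z. (\<lambda>(u, w). b u w * (?f u)\<^sup>2) z + (\<lambda>(u, w). b u w * (cmod (A u w))\<^sup>2) z) summable_on (V \<times> V)"
      using rows W by (intro summable_on_add) (auto simp: summable_on_def)
    show "norm (?F z) \<le> (\<lambda>(u, w). b u w * (?f u)\<^sup>2) z + (\<lambda>(u, w). b u w * (cmod (A u w))\<^sup>2) z"
      if z: "z \<in> V \<times> V" for z
    proof -
      obtain u w where uw: "z = (u, w)" by (cases z)
      have "?f u * cmod (A u w) \<le> (?f u)\<^sup>2 + (cmod (A u w))\<^sup>2"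
        using sum_squares_bound[of "?f u" "cmod (A u w)"]
          mult_nonneg_nonneg[OF f0[of u] norm_ge_zero[of "A u w"]] by linarith
      then have "b u w * (?f u * cmod (A u w)) \<le> b u w * ((?f u)\<^sup>2 + (cmod (A u w))\<^sup>2)"
        using z uw nonneg by (intro mult_left_mono) auto
      then show ?thesis using uw z nonneg f0[of u] by (auto simp: norm_mult algebra_simps)
    qed
  qed
  then obtain T where T: "(?F has_sum T) (V \<times> V)"
    using abs_summable_summable by (auto simp: summable_on_def)
  have "((\<lambda>u. of_real (?f u) * (s * indicator {v} u)) has_sum T) V"
    by (rule has_sum_SigmaD[OF T]) (use has_sum_cmult_right[OF div] in simp)
  moreover have "((\<lambda>u. of_real (?f u) * (s * indicator {v} u))
      has_sum of_real (?f v) * (s * indicator {v} v)) V"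
    by (rule has_sum_at_point[OF v]) simp
  ultimately have T_eq: "T = of_real (?f v) * s"
    using has_sum_unique by fastforce
  \<comment> \<open>Summing \<open>?F\<close> by rows gives the divergence; adding the transposed sum produces the gradient.\<close>
  have "((\<lambda>(u, w). of_real (?f w) * (b w u * A w u)) has_sum T) (V \<times> V)"
    using T by (subst (asm) has_sum_swap) simp
  from has_sum_add[OF T has_sum_cmult_right[OF this, of 1]]
  have "((\<lambda>z. ?F z + 1 * (\<lambda>(u, w). of_real (?f w) * (b w u * A w u)) z) has_sum T + 1 * T) (V \<times> V)" .
  then have gradient: "((\<lambda>(u, w). of_real (?f u - ?f w) * (b u w * A u w)) has_sum T + 1 * T) (V \<times> V)"
  proof (rule has_sum_cong[THEN iffD1, rotated])
    fix z assume z: "z \<in> V \<times> V"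
    obtain u w where uw: "z = (u, w)" by (cases z)
    have flip: "of_real (b w u) * A w u = - (of_real (b u w) * A u w)"
      using anti[of u w] symmetric[of u w] z uw by simp
    then show "?F z + 1 * (\<lambda>(u, w). of_real (?f w) * (b w u * A w u)) z
        = (\<lambda>(u, w). of_real (?f u - ?f w) * (b u w * A u w)) z"
      unfolding uw prod.case flip by (simp add: algebra_simps)
  qed
  \<comment> \<open>This \<open>t\<close> lets the energy term absorb exactly half of \<open>2 * cmod s * f v\<close>.\<close>
  define t where "t = cmod s / deg v"
  have t: "0 < t" using False deg_pos[OF v] by (simp add: t_def)
  have "((\<lambda>z. t / 2 * (\<lambda>(u, w). b u w * (?f u - ?f w)\<^sup>2) z
      + 1 / (2 * t) * (\<lambda>(u, w). b u w * (cmod (A u w))\<^sup>2) z) has_sum t / 2 * E + 1 / (2 * t) * W) (V \<times> V)"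
    by (intro has_sum_add has_sum_cmult_right E W)
  with gradient have "norm (T + 1 * T) \<le> t / 2 * E + 1 / (2 * t) * W"
  proof (rule norm_infsum_le)
    fix z assume z: "z \<in> V \<times> V"
    obtain u w where uw: "z = (u, w)" by (cases z)
    \<comment> \<open>The weighted inequality between arithmetic and geometric mean.\<close>
    have "\<bar>x\<bar> * y \<le> t / 2 * x\<^sup>2 + 1 / (2 * t) * y\<^sup>2" for x y :: real
    proof -
      have "0 \<le> (t * \<bar>x\<bar> - y)\<^sup>2 / (2 * t)" using t by simp
      also have "\<dots> = t / 2 * x\<^sup>2 + 1 / (2 * t) * y\<^sup>2 - \<bar>x\<bar> * y"
        using t by (simp add: power2_eq_square field_simps)
      finally show ?thesis by simp
    qed
    from mult_left_mono[OF this[of "?f u - ?f w" "cmod (A u w)"], of "b u w"]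
    have "b u w * (\<bar>?f u - ?f w\<bar> * cmod (A u w))
        \<le> b u w * (t / 2 * (?f u - ?f w)\<^sup>2 + 1 / (2 * t) * (cmod (A u w))\<^sup>2)"
      using z uw nonneg by auto
    moreover have "norm ((\<lambda>(u, w). of_real (?f u - ?f w) * (b u w * A u w)) z)
        = b u w * (\<bar>?f u - ?f w\<bar> * cmod (A u w))"
      using z uw nonneg by (auto simp: norm_mult simp flip: of_real_diff)
    ultimately show "norm ((\<lambda>(u, w). of_real (?f u - ?f w) * (b u w * A u w)) z)
        \<le> t / 2 * (\<lambda>(u, w). b u w * (?f u - ?f w)\<^sup>2) z + 1 / (2 * t) * (\<lambda>(u, w). b u w * (cmod (A u w))\<^sup>2) z"
      using uw by (simp add: algebra_simps)
  qed
  moreover have "norm (T + 1 * T) = 2 * (cmod s * ?f v)"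
    using f0[of v] by (simp add: T_eq norm_mult flip: mult_2)
  moreover have "t / 2 * E \<le> t / 2 * (2 * deg v * ?f v)"
    using E_le t by (intro mult_left_mono) auto
  moreover have "t / 2 * (2 * deg v * ?f v) = cmod s * ?f v"
    using deg_pos[OF v] by (simp add: t_def)
  ultimately have "cmod s * ?f v \<le> 1 / (2 * t) * W" by linarith
  then have "2 * cmod s * (cmod s * ?f v) \<le> 2 * cmod s * (1 / (2 * t) * W)"
    by (intro mult_left_mono) auto
  also have "2 * cmod s * (1 / (2 * t) * W) = deg v * W"
    using False deg_pos[OF v] by (simp add: t_def)
  finally show ?thesis by (simp add: power2_eq_square)
qed

text \<open>
  The energy bound passes to the limit because each finite partial sum of the energy of \<open>g\<close> is a limit of
  partial sums for truncated Green functions.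
\<close>

lemma finite_energy_green_function:
  assumes v: "v \<in> V" and bound: "\<And>N. green_trunc step v N v \<le> B"
  obtains g :: "'a \<Rightarrow> real" where "(\<lambda>(u, w). b u w * (g u - g w)\<^sup>2) summable_on (V \<times> V)"
    and "\<And>u. u \<in> V \<Longrightarrow> ((\<lambda>w. b u w * (g u - g w)) has_sum deg v * indicator {v} u) V"
proof -
  obtain g where lim: "\<And>u. (\<lambda>N. green_trunc step v N u) \<longlonglongrightarrow> g u"
    and g0: "\<And>u. 0 \<le> g u" and gB: "\<And>u. g u \<le> B"
    and g: "\<And>u. g u = indicator {v} u + measure_pmf.expectation (step u) g"
    using green_function_exists[of step v B, OF bound] by metis
  have "(\<lambda>(u, w). b u w * (g u - g w)\<^sup>2) summable_on (V \<times> V)"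
  proof (rule nonneg_bdd_above_summable_on)
    show "bdd_above (sum (\<lambda>(u, w). b u w * (g u - g w)\<^sup>2) ` {F. F \<subseteq> V \<times> V \<and> finite F})"
    proof (rule bdd_aboveI2)
      fix F assume F: "F \<in> {F. F \<subseteq> V \<times> V \<and> finite F}"
      let ?e = "\<lambda>N. \<Sum>(u, w)\<in>F. b u w * (green_trunc step v N u - green_trunc step v N w)\<^sup>2"
      have "?e \<longlonglongrightarrow> (\<Sum>(u, w)\<in>F. b u w * (g u - g w)\<^sup>2)"
        unfolding case_prod_unfold by (intro tendsto_intros lim)
      moreover have "?e N \<le> 2 * deg v * B" for N
      proof -
        obtain E where E: "((\<lambda>(u, w). b u w * (green_trunc step v N u - green_trunc step v N w)\<^sup>2)
            has_sum E) (V \<times> V)" and "E \<le> 2 * deg v * green_trunc step v N v"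
          by (rule green_trunc_energy[OF v])
        moreover have "?e N \<le> E"
          by (rule finite_sum_le_has_sum[OF E]) (use F nonneg in auto)
        moreover have "2 * deg v * green_trunc step v N v \<le> 2 * deg v * B"
          using bound[of N] deg_nonneg[OF v] by (intro mult_left_mono) auto
        ultimately show ?thesis by linarith
      qed
      ultimately show "(\<Sum>(u, w)\<in>F. b u w * (g u - g w)\<^sup>2) \<le> 2 * deg v * B"
        by (intro LIMSEQ_le_const2) auto
    qed
  qed (use nonneg in auto)
  moreover have "((\<lambda>w. b u w * (g u - g w)) has_sum deg v * indicator {v} u) V" if u: "u \<in> V" for u
  proof -
    have "((\<lambda>w. b u w * g u + (- 1) * (b u w * g w))
        has_sum deg u * g u + (- 1) * (deg u * measure_pmf.expectation (step u) g)) V"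
      by (intro has_sum_add has_sum_cmult_left has_sum_cmult_right has_sum_deg u
          has_sum_step_expectation[OF u deg_pos[OF u], of _ B])
         (use g0 gB in \<open>simp add: abs_of_nonneg\<close>)
    moreover have "deg u * g u + (- 1) * (deg u * measure_pmf.expectation (step u) g) = deg v * indicator {v} u"
      by (subst g[of u]) (auto simp: distrib_left split: split_indicator)
    ultimately show ?thesis by (simp add: right_diff_distrib)
  qed
  ultimately show thesis by (rule that)
qed

end

context weighted_graph begin

lemma weighted_graph_walkI:
  assumes conn: "connected_graph V b" and nontriv: "\<not> (\<exists>x. V = {x})"
  shows "weighted_graph_walk V b"
proof
  fix u assume u: "u \<in> V"
  then obtain w where w: "w \<in> V" "w \<noteq> u" using nontriv by blast
  then have "graph_joined V b u w" using conn u by (simp add: connected_graph_def)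
  then obtain z where "z \<in> V" "0 < b u z"
    using w(2) unfolding graph_joined_def by (auto elim: converse_rtranclpE)
  then show "0 < deg u" using u by (intro deg_pos_if_edge)
qed

text \<open>
  On a single vertex antisymmetry alone forces \<open>s = 0\<close>; this case is recurrent by convention,
  independently of the walk.
\<close>

lemma recurrent_no_finite_energy_flow:
  fixes A :: "'a \<Rightarrow> 'a \<Rightarrow> complex"
  assumes rec: "recurrent_graph V b" and v: "v \<in> V"
    and anti: "\<And>u w. u \<in> V \<Longrightarrow> w \<in> V \<Longrightarrow> b u w * A w u = - (b u w * A u w)"
    and W: "(\<lambda>(u, w). b u w * (cmod (A u w))\<^sup>2) summable_on (V \<times> V)"
    and div: "\<And>u. u \<in> V \<Longrightarrow> ((\<lambda>w. b u w * A u w) has_sum s * indicator {v} u) V"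
  shows "s = 0"
proof (cases "\<exists>x. V = {x}")
  case True
  then have V: "V = {v}" using v by auto
  have "((\<lambda>w. b v w * A v w) has_sum b v v * A v v) V"
    by (rule has_sum_at_point[OF v]) (simp add: V)
  then have "s = b v v * A v v" using div[OF v] has_sum_unique by fastforce
  then show ?thesis using anti[OF v v] by auto
next
  case False
  then interpret weighted_graph_walk V b
    using rec by (intro weighted_graph_walkI) (auto simp: recurrent_graph_def)
  show ?thesis
  proof (rule ccontr)
    assume s: "s \<noteq> 0"
    have "(\<lambda>n. avoid_prob step v n v) \<longlonglongrightarrow> 0"
      using rec False v by (auto simp: recurrent_graph_def chain_hits_iff_avoid_prob_tendsto_0)
    moreover obtain W' where "((\<lambda>(u, w). b u w * (cmod (A u w))\<^sup>2) has_sum W') (V \<times> V)"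
      using W by (auto simp: summable_on_def)
    then have "green_trunc step v N v \<le> deg v * W' / (2 * (cmod s)\<^sup>2)" for N
      using flow_bounds_green_trunc[OF v anti _ div] s by (simp add: field_simps)
    ultimately show False using green_unbounded_if_returns[of step v "deg v * W' / (2 * (cmod s)\<^sup>2)"] by blast
  qed
qed

lemma transient_finite_energy_potential:
  assumes trans: "transient_graph V b" and v: "v \<in> V"
  obtains g :: "'a \<Rightarrow> real" where "(\<lambda>(u, w). b u w * (g u - g w)\<^sup>2) summable_on (V \<times> V)"
    and "\<And>u. u \<in> V \<Longrightarrow> ((\<lambda>w. b u w * (g u - g w)) has_sum indicator {v} u) V"
proof -
  have conn: "connected_graph V b" and nontriv: "\<not> (\<exists>x. V = {x})"
    using trans by (auto simp: transient_graph_def recurrent_graph_def)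
  interpret weighted_graph_walk V b by (rule weighted_graph_walkI[OF conn nontriv])
  obtain x y where xy: "x \<in> V" "y \<in> V" and miss: "\<not> (\<lambda>n. avoid_prob step y n x) \<longlonglongrightarrow> 0"
    using trans nontriv
    by (auto simp: transient_graph_def recurrent_graph_def chain_hits_iff_avoid_prob_tendsto_0)
  have path: "(\<lambda>u w. 0 < pmf (step u) w)\<^sup>*\<^sup>* u w" if "u \<in> V" "w \<in> V" for u w
  proof -
    have "graph_joined V b u w" using conn that by (simp add: connected_graph_def)
    then show ?thesis
      unfolding graph_joined_def
      by (rule rtranclp_mono[THEN predicate2D, rotated]) (auto simp: pmf_graph_step deg_pos)
  qed
  obtain B where "\<And>N. green_trunc step v N v \<le> B"
    using green_bounded_if_not_hitting[OF path[OF xy(2,1)] path[OF v xy(2)] miss] by blast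
  then obtain g where energy: "(\<lambda>(u, w). b u w * (g u - g w)\<^sup>2) summable_on (V \<times> V)"
    and lap: "\<And>u. u \<in> V \<Longrightarrow> ((\<lambda>w. b u w * (g u - g w)) has_sum deg v * indicator {v} u) V"
    using finite_energy_green_function[OF v] by blast
  show thesis
  proof (rule that[of "\<lambda>u. g u / deg v"])
    have "(\<lambda>z. (1 / deg v)\<^sup>2 * (\<lambda>(u, w). b u w * (g u - g w)\<^sup>2) z) summable_on (V \<times> V)"
      by (rule summable_on_cmult_right[OF energy])
    then show "(\<lambda>(u, w). b u w * (g u / deg v - g w / deg v)\<^sup>2) summable_on (V \<times> V)"
      by (rule summable_on_cong[THEN iffD1, rotated])
         (auto simp: power_divide simp flip: diff_divide_distrib)
    show "((\<lambda>w. b u w * (g u / deg v - g w / deg v)) has_sum indicator {v} u) V" if "u \<in> V" for u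
      using has_sum_divide_const[OF lap[OF that], of "deg v"] deg_pos[OF v]
      by (simp flip: diff_divide_distrib)
  qed
qed

end

section \<open>Components of weighted graphs\<close>

lemma graph_component_closed:
  assumes "C \<in> graph_components L b" "u \<in> C" "w \<in> L" "0 < b u w"
  shows "w \<in> C"
  using assms unfolding graph_components_def graph_joined_def
  by (auto elim!: rtranclp.rtrancl_into_rtrancl)

lemma graph_component_subset: "C \<in> graph_components L b \<Longrightarrow> C \<subseteq> L"
  by (auto simp: graph_components_def)

text \<open>
  Paths are required to stay inside the component here, while components are defined by paths in the
  whole graph; a path that starts in a component never leaves it.
\<close>

lemma graph_component_connected:
  assumes C: "C \<in> graph_components L b" and sym: "\<And>u w. b u w = b w u"
  shows "connected_graph C b"
proof -
  obtain x where x: "x \<in> L" and C_eq: "C = {y\<in>L. graph_joined L b x y}"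
    using C by (auto simp: graph_components_def)
  have xC: "x \<in> C" using x C_eq by (simp add: graph_joined_def)
  have to: "graph_joined C b x y" if "y \<in> C" for y
  proof -
    have "(\<lambda>x y. x \<in> L \<and> y \<in> L \<and> 0 < b x y)\<^sup>*\<^sup>* x y"
      using that C_eq by (simp add: graph_joined_def)
    then have "y \<in> C \<and> (\<lambda>x y. x \<in> C \<and> y \<in> C \<and> 0 < b x y)\<^sup>*\<^sup>* x y"
    proof induction
      case (step y z)
      then have "z \<in> C" using graph_component_closed[OF C, of y z] by blast
      with step show ?case by (auto intro: rtranclp.rtrancl_into_rtrancl)
    qed (simp add: xC)
    then show ?thesis by (simp add: graph_joined_def)
  qed
  have "symp (\<lambda>x y. x \<in> C \<and> y \<in> C \<and> 0 < b x y)" by (auto simp: symp_def sym)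
  then have "graph_joined C b y x" if "y \<in> C" for y
    using to[OF that] unfolding graph_joined_def by (metis symp_rtranclp sympD)
  then have "graph_joined C b y z" if "y \<in> C" "z \<in> C" for y z
    using to that unfolding graph_joined_def by (meson rtranclp_trans)
  then show ?thesis using xC by (auto simp: connected_graph_def)
qed

lemma mem_link_iff: "v \<in> link S \<rho> \<longleftrightarrow> v \<notin> \<rho> \<and> insert v \<rho> \<in> S"
proof -
  have "insert v \<rho> - \<rho> = (if v \<in> \<rho> then {} else {v})" by auto
  then show ?thesis by (auto simp: link_def codim1_face_def)
qed

section \<open>Simplices around a fixed simplex as edges of its link graph\<close>

locale oriented_complex =
  fixes X :: "'a set" and K S :: "'a set set" and m :: "'a set \<Rightarrow> real"
    and \<theta> :: "'a set \<Rightarrow> 'a set \<Rightarrow> complex"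
  assumes weighted: "weighted_simplicial_complex X K m S"
    and coeffs: "coboundary_coeffs S \<theta>"
begin

lemma finite_simplex: "\<sigma> \<in> S \<Longrightarrow> finite \<sigma>"
  and weight_pos: "\<sigma> \<in> S \<Longrightarrow> 0 < m \<sigma>"
  and cofaces_summable: "\<sigma> \<in> S \<Longrightarrow> m summable_on cofaces S \<sigma>"
  using weighted by (auto simp: weighted_simplicial_complex_def abstract_simplicial_complex_def split: if_splits)

lemma nonempty_subset_in_complex: "\<sigma> \<in> S \<Longrightarrow> \<tau> \<subseteq> \<sigma> \<Longrightarrow> \<tau> \<noteq> {} \<Longrightarrow> \<tau> \<in> S"
  using weighted by (auto simp: weighted_simplicial_complex_def abstract_simplicial_complex_def split: if_splits)

lemma coeff_cases: "\<sigma> \<in> S \<Longrightarrow> \<tau> \<in> S \<Longrightarrow> codim1_face \<tau> \<sigma> \<Longrightarrow> \<theta> \<tau> \<sigma> = 1 \<or> \<theta> \<tau> \<sigma> = -1"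
  using coeffs by (auto simp: coboundary_coeffs_def faces_def)

lemma codim1_face_insert: "x \<notin> \<tau> \<Longrightarrow> codim1_face \<tau> (insert x \<tau>)"
  by (auto simp: codim1_face_def insert_Diff_if)

lemma codim1_faceE:
  assumes "codim1_face \<tau> \<sigma>"
  obtains x where "x \<notin> \<tau>" "\<sigma> = insert x \<tau>"
proof -
  obtain x where "\<sigma> - \<tau> = {x}" using assms by (auto simp: codim1_face_def card_1_singleton_iff)
  then show thesis using assms that[of x] by (auto simp: codim1_face_def)
qed

lemma link_graph_nonzero_iff:
  "link_graph S m \<rho> u w \<noteq> 0 \<longleftrightarrow> u \<notin> \<rho> \<and> w \<notin> \<rho> \<and> u \<noteq> w \<and> {u, w} \<union> \<rho> \<in> S"
proof -
  have "insert u \<rho> \<in> S" "insert w \<rho> \<in> S" if "{u, w} \<union> \<rho> \<in> S"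
    using nonempty_subset_in_complex[OF that, of "insert u \<rho>"]
      nonempty_subset_in_complex[OF that, of "insert w \<rho>"] by auto
  then show ?thesis using weight_pos[of "{u, w} \<union> \<rho>"] by (auto simp: link_graph_def mem_link_iff)
qed

lemma link_graph_eq: "link_graph S m \<rho> u w \<noteq> 0 \<Longrightarrow> link_graph S m \<rho> u w = m ({u, w} \<union> \<rho>)"
  by (auto simp: link_graph_def)

lemma link_graph_commute: "link_graph S m \<rho> u w = link_graph S m \<rho> w u"
  by (auto simp: link_graph_def insert_commute)

lemma link_graph_nonneg: "0 \<le> link_graph S m \<rho> u w"
  using link_graph_nonzero_iff[of \<rho> u w] link_graph_eq[of \<rho> u w] weight_pos[of "{u, w} \<union> \<rho>"]
  by (cases "link_graph S m \<rho> u w = 0") auto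

lemma link_graph_mem_link:
  assumes "link_graph S m \<rho> u w \<noteq> 0"
  shows "u \<in> link S \<rho>" "w \<in> link S \<rho>"
  using assms by (auto simp: link_graph_def split: if_splits)

lemma link_graph_component:
  assumes C: "C \<in> graph_components (link S \<rho>) (link_graph S m \<rho>)" and b: "link_graph S m \<rho> u w \<noteq> 0"
  shows "u \<in> C \<longleftrightarrow> w \<in> C"
  using graph_component_closed[OF C, of u w] graph_component_closed[OF C, of w u]
    link_graph_mem_link[OF b] b link_graph_nonneg[of \<rho> u w] link_graph_commute[of \<rho> u w] by auto

text \<open>
  The cofaces of \<open>u\<rho>\<close> are the edges at \<open>u\<close> of the link graph of \<open>\<rho>\<close>.
\<close>

lemma cofaces_insert:
  assumes u: "u \<in> link S \<rho>"
  shows "bij_betw (\<lambda>w. {u, w} \<union> \<rho>) {w. link_graph S m \<rho> u w \<noteq> 0} (cofaces S (insert u \<rho>))"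
proof (rule bij_betw_imageI)
  show "inj_on (\<lambda>w. {u, w} \<union> \<rho>) {w. link_graph S m \<rho> u w \<noteq> 0}"
    by (auto simp: inj_on_def link_graph_nonzero_iff)
  show "(\<lambda>w. {u, w} \<union> \<rho>) ` {w. link_graph S m \<rho> u w \<noteq> 0} = cofaces S (insert u \<rho>)"
  proof (intro equalityI subsetI)
    fix \<tau> assume "\<tau> \<in> (\<lambda>w. {u, w} \<union> \<rho>) ` {w. link_graph S m \<rho> u w \<noteq> 0}"
    then obtain w where w: "\<tau> = {u, w} \<union> \<rho>" "link_graph S m \<rho> u w \<noteq> 0" by auto
    then have "\<tau> = insert w (insert u \<rho>)" "w \<notin> insert u \<rho>" "\<tau> \<in> S"
      by (auto simp: link_graph_nonzero_iff)
    then show "\<tau> \<in> cofaces S (insert u \<rho>)" using codim1_face_insert[of w "insert u \<rho>"] by (simp add: cofaces_def)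
  next
    fix \<tau> assume \<tau>: "\<tau> \<in> cofaces S (insert u \<rho>)"
    then obtain w where "w \<notin> insert u \<rho>" "\<tau> = insert w (insert u \<rho>)"
      by (auto simp: cofaces_def elim: codim1_faceE)
    then have "\<tau> = {u, w} \<union> \<rho>" "link_graph S m \<rho> u w \<noteq> 0"
      using u \<tau> by (auto simp: link_graph_nonzero_iff mem_link_iff cofaces_def insert_commute)
    then show "\<tau> \<in> (\<lambda>w. {u, w} \<union> \<rho>) ` {w. link_graph S m \<rho> u w \<noteq> 0}" by blast
  qed
qed

lemma has_sum_cofaces_iff:
  fixes F :: "'a set \<Rightarrow> 'b::real_normed_vector"
  assumes u: "u \<in> link S \<rho>" and V: "\<And>w. link_graph S m \<rho> u w \<noteq> 0 \<Longrightarrow> w \<in> V"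
  shows "((\<lambda>w. link_graph S m \<rho> u w *\<^sub>R F ({u, w} \<union> \<rho>)) has_sum s) V \<longleftrightarrow>
    ((\<lambda>\<tau>. m \<tau> *\<^sub>R F \<tau>) has_sum s) (cofaces S (insert u \<rho>))"
proof -
  let ?b = "link_graph S m \<rho> u"
  have "((\<lambda>\<tau>. m \<tau> *\<^sub>R F \<tau>) has_sum s) (cofaces S (insert u \<rho>)) \<longleftrightarrow>
      ((\<lambda>w. m ({u, w} \<union> \<rho>) *\<^sub>R F ({u, w} \<union> \<rho>)) has_sum s) {w. ?b w \<noteq> 0}"
    by (rule has_sum_reindex_bij_betw[OF cofaces_insert[OF u], symmetric])
  also have "\<dots> \<longleftrightarrow> ((\<lambda>w. ?b w *\<^sub>R F ({u, w} \<union> \<rho>)) has_sum s) V"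
    by (rule has_sum_cong_neutral) (use V link_graph_eq[of \<rho> u] in auto)
  finally show ?thesis by simp
qed

lemma weighted_graph_link:
  assumes C: "C \<in> graph_components (link S \<rho>) (link_graph S m \<rho>)"
  shows "weighted_graph C (link_graph S m \<rho>)"
proof
  fix u assume uC: "u \<in> C"
  then have u: "u \<in> link S \<rho>" using graph_component_subset[OF C] by blast
  then have "insert u \<rho> \<in> S" by (simp add: mem_link_iff)
  then obtain s where "(m has_sum s) (cofaces S (insert u \<rho>))"
    using cofaces_summable by (auto simp: summable_on_def)
  then have "((\<lambda>w. link_graph S m \<rho> u w *\<^sub>R (1::real)) has_sum s) C"
    by (subst has_sum_cofaces_iff[OF u]) (use link_graph_component[OF C] uC in auto)
  then show "link_graph S m \<rho> u summable_on C" by (auto simp: summable_on_def)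
qed (use link_graph_nonneg link_graph_commute in auto)

text \<open>
  Evaluate \<open>\<delta>\<delta>1\<^sub>\<rho> = 0\<close> at \<open>{u, w} \<union> \<rho>\<close>: exactly two simplices lie strictly between \<open>\<rho>\<close> and this simplex,
  namely \<open>u\<rho>\<close> and \<open>w\<rho>\<close>.
\<close>

lemma coboundary_squared_two_terms:
  assumes \<rho>: "\<rho> \<in> S" and b: "link_graph S m \<rho> u w \<noteq> 0"
  shows "\<theta> \<rho> (insert u \<rho>) * \<theta> (insert u \<rho>) ({u, w} \<union> \<rho>)
    = - (\<theta> \<rho> (insert w \<rho>) * \<theta> (insert w \<rho>) ({u, w} \<union> \<rho>))"
proof -
  let ?\<tau> = "{u, w} \<union> \<rho>"
  have uw: "u \<notin> \<rho>" "w \<notin> \<rho>" "u \<noteq> w" and \<tau>: "?\<tau> \<in> S"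
    using b by (auto simp: link_graph_nonzero_iff)
  have fin: "finite (faces S \<sigma>)" if "\<sigma> \<in> S" for \<sigma>
    using finite_simplex[OF that] by (rule finite_subset[rotated, OF finite_Pow_iff[THEN iffD2]]) (auto simp: faces_def codim1_face_def)
  have inner: "coboundary S \<theta> (indicator {\<rho>}) \<sigma> = (if \<rho> \<in> faces S \<sigma> then \<theta> \<rho> \<sigma> else 0)" if "\<sigma> \<in> S" for \<sigma>
    using fin[OF that] by (simp add: coboundary_def indicator_def if_distrib[of "\<lambda>x. _ * x"] sum.delta cong: if_cong)
  have face: "insert x \<rho> \<in> faces S ?\<tau>" "\<rho> \<in> faces S (insert x \<rho>)" if "x \<in> {u, w}" for x
  proof -
    have "insert x \<rho> \<in> S" using nonempty_subset_in_complex[OF \<tau>, of "insert x \<rho>"] that by auto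
    moreover have "?\<tau> - insert x \<rho> = {u, w} - {x}" using uw by auto
    then have "card (?\<tau> - insert x \<rho>) = 1" using that uw by auto
    ultimately show "insert x \<rho> \<in> faces S ?\<tau>" using that by (auto simp: faces_def codim1_face_def)
    show "\<rho> \<in> faces S (insert x \<rho>)" using \<rho> uw that codim1_face_insert[of x \<rho>] by (auto simp: faces_def)
  qed
  have "0 = coboundary S \<theta> (coboundary S \<theta> (indicator {\<rho>})) ?\<tau>"
    using coeffs \<tau> unfolding coboundary_coeffs_def by metis
  also have "\<dots> = (\<Sum>\<sigma>\<in>faces S ?\<tau>. \<theta> \<sigma> ?\<tau> * (if \<rho> \<in> faces S \<sigma> then \<theta> \<rho> \<sigma> else 0))"
    unfolding coboundary_def[of S \<theta> "coboundary S \<theta> (indicator {\<rho>})"]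
    by (rule sum.cong) (auto simp: inner faces_def)
  also have "\<dots> = (\<Sum>\<sigma>\<in>{insert u \<rho>, insert w \<rho>}. \<theta> \<sigma> ?\<tau> * (if \<rho> \<in> faces S \<sigma> then \<theta> \<rho> \<sigma> else 0))"
  proof (rule sum.mono_neutral_right[OF fin[OF \<tau>]])
    show "{insert u \<rho>, insert w \<rho>} \<subseteq> faces S ?\<tau>" using face by blast
    show "\<forall>\<sigma>\<in>faces S ?\<tau> - {insert u \<rho>, insert w \<rho>}. \<theta> \<sigma> ?\<tau> * (if \<rho> \<in> faces S \<sigma> then \<theta> \<rho> \<sigma> else 0) = 0"
    proof
      fix \<sigma> assume \<sigma>: "\<sigma> \<in> faces S ?\<tau> - {insert u \<rho>, insert w \<rho>}"
      have "\<rho> \<notin> faces S \<sigma>"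
      proof
        assume "\<rho> \<in> faces S \<sigma>"
        then obtain x where "x \<notin> \<rho>" "\<sigma> = insert x \<rho>" by (auto simp: faces_def elim: codim1_faceE)
        then show False using \<sigma> by (auto simp: faces_def codim1_face_def)
      qed
      then show "\<theta> \<sigma> ?\<tau> * (if \<rho> \<in> faces S \<sigma> then \<theta> \<rho> \<sigma> else 0) = 0" by simp
    qed
  qed
  also have "\<dots> = \<theta> (insert u \<rho>) ?\<tau> * \<theta> \<rho> (insert u \<rho>) + \<theta> (insert w \<rho>) ?\<tau> * \<theta> \<rho> (insert w \<rho>)"
  proof -
    have "insert u \<rho> \<noteq> insert w \<rho>" using uw by blast
    then show ?thesis using face by simp
  qed
  finally show ?thesis by (simp add: eq_neg_iff_add_eq_0 mult.commute)
qed

lemma coeff_square: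
  assumes \<rho>: "\<rho> \<in> S" and u: "u \<in> link S \<rho>"
  shows "\<theta> \<rho> (insert u \<rho>) * \<theta> \<rho> (insert u \<rho>) = 1" "cmod (\<theta> \<rho> (insert u \<rho>)) = 1"
  using coeff_cases[OF _ \<rho> codim1_face_insert, of u] u by (auto simp: mem_link_iff)

lemma coeff_square_coface:
  assumes "link_graph S m \<rho> u w \<noteq> 0"
  shows "\<theta> (insert u \<rho>) ({u, w} \<union> \<rho>) * \<theta> (insert u \<rho>) ({u, w} \<union> \<rho>) = 1"
    "cmod (\<theta> (insert u \<rho>) ({u, w} \<union> \<rho>)) = 1"
proof -
  have eq: "{u, w} \<union> \<rho> = insert w (insert u \<rho>)" by auto
  have "w \<notin> insert u \<rho>" "insert w (insert u \<rho>) \<in> S" "insert u \<rho> \<in> S"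
    using assms link_graph_mem_link[OF assms] eq by (auto simp: link_graph_nonzero_iff mem_link_iff)
  from coeff_cases[OF this(2,3) codim1_face_insert[OF this(1)]]
  show "\<theta> (insert u \<rho>) ({u, w} \<union> \<rho>) * \<theta> (insert u \<rho>) ({u, w} \<union> \<rho>) = 1"
    "cmod (\<theta> (insert u \<rho>) ({u, w} \<union> \<rho>)) = 1"
    unfolding eq by auto
qed

lemma boundary_eqI:
  assumes u: "u \<in> link S \<rho>" and V: "\<And>w. link_graph S m \<rho> u w \<noteq> 0 \<Longrightarrow> w \<in> V"
    and sum: "((\<lambda>w. link_graph S m \<rho> u w * (\<theta> (insert u \<rho>) ({u, w} \<union> \<rho>) * \<omega> ({u, w} \<union> \<rho>))) has_sum s) V"
  shows "boundary S m \<theta> \<omega> (insert u \<rho>) = s / of_real (m (insert u \<rho>))"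
proof -
  have "((\<lambda>\<tau>. m \<tau> *\<^sub>R (\<theta> (insert u \<rho>) \<tau> * \<omega> \<tau>)) has_sum s) (cofaces S (insert u \<rho>))"
    by (subst has_sum_cofaces_iff[OF u V, symmetric]) (use sum in \<open>auto simp: scaleR_conv_of_real\<close>)
  then have "(\<Sum>\<^sub>\<infinity>\<tau>\<in>cofaces S (insert u \<rho>). of_real (m \<tau>) * \<theta> (insert u \<rho>) \<tau> * \<omega> \<tau>) = s"
    by (intro infsumI) (simp add: scaleR_conv_of_real mult.assoc)
  then show ?thesis by (simp add: boundary_def)
qed

lemma has_sum_boundary:
  assumes \<omega>: "\<omega> \<in> l2 S m" and u: "u \<in> link S \<rho>" and V: "\<And>w. link_graph S m \<rho> u w \<noteq> 0 \<Longrightarrow> w \<in> V"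
  shows "((\<lambda>w. link_graph S m \<rho> u w * (\<theta> (insert u \<rho>) ({u, w} \<union> \<rho>) * \<omega> ({u, w} \<union> \<rho>)))
    has_sum of_real (m (insert u \<rho>)) * boundary S m \<theta> \<omega> (insert u \<rho>)) V"
proof -
  let ?F = "\<lambda>\<tau>. \<theta> (insert u \<rho>) \<tau> * \<omega> \<tau>"
  have u\<rho>: "insert u \<rho> \<in> S" using u by (simp add: mem_link_iff)
  have "\<omega> \<in> boundary_domain S m" using l2_subset_boundary_domain[OF weighted] \<omega> by blast
  then have "(\<lambda>\<tau>. m \<tau> * cmod (\<omega> \<tau>)) summable_on cofaces S (insert u \<rho>)"
    using u\<rho> by (simp add: boundary_domain_def)
  then have "(\<lambda>\<tau>. norm (m \<tau> *\<^sub>R ?F \<tau>)) summable_on cofaces S (insert u \<rho>)"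
  proof (rule Infinite_Sum.abs_summable_on_comparison_test')
    fix \<tau> assume \<tau>: "\<tau> \<in> cofaces S (insert u \<rho>)"
    then have "\<theta> (insert u \<rho>) \<tau> = 1 \<or> \<theta> (insert u \<rho>) \<tau> = -1"
      using u\<rho> by (intro coeff_cases) (auto simp: cofaces_def)
    then show "norm (m \<tau> *\<^sub>R ?F \<tau>) \<le> m \<tau> * cmod (\<omega> \<tau>)"
      using weight_pos[of \<tau>] \<tau> by (auto simp: cofaces_def norm_mult)
  qed
  then obtain s where s: "((\<lambda>\<tau>. m \<tau> *\<^sub>R ?F \<tau>) has_sum s) (cofaces S (insert u \<rho>))"
    using abs_summable_summable has_sum_infsum by metis
  then have sum: "((\<lambda>w. link_graph S m \<rho> u w * ?F ({u, w} \<union> \<rho>)) has_sum s) V"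
    using has_sum_cofaces_iff[OF u V, where F = ?F and s = s] by (simp add: scaleR_conv_of_real)
  moreover have "of_real (m (insert u \<rho>)) * boundary S m \<theta> \<omega> (insert u \<rho>) = s"
    using boundary_eqI[OF u V sum] weight_pos[OF u\<rho>] by simp
  ultimately show ?thesis by simp
qed

text \<open>
  Each simplex \<open>\<tau>\<close> with two vertices outside \<open>\<rho>\<close> arises from the two oriented edges of \<open>\<tau> - \<rho>\<close>, so the sum over
  oriented edges is at most twice the sum over simplices. The orientation is recorded by the
  initial vertex, which makes \<open>(u, w) \<mapsto> ({u, w} \<union> \<rho>, u)\<close> injective.
\<close>

lemma l2_summable_on_link_pairs:
  assumes \<omega>: "\<omega> \<in> l2 S m"
  shows "(\<lambda>(u, w). link_graph S m \<rho> u w * (cmod (\<omega> ({u, w} \<union> \<rho>)))\<^sup>2) summable_on V"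
proof -
  let ?T = "{\<tau>\<in>S. \<rho> \<subseteq> \<tau> \<and> card (\<tau> - \<rho>) = 2}"
  let ?f = "\<lambda>\<tau>. m \<tau> * (cmod (\<omega> \<tau>))\<^sup>2"
  let ?P = "{(u, w). link_graph S m \<rho> u w \<noteq> 0}"
  let ?h = "\<lambda>(u, w). ({u, w} \<union> \<rho>, u)"
  have "(\<lambda>(\<tau>, u). ?f \<tau>) summable_on Sigma ?T (\<lambda>\<tau>. \<tau> - \<rho>)"
  proof (rule summable_on_SigmaI)
    show "((\<lambda>u. case (\<tau>, u) of (\<tau>, u) \<Rightarrow> ?f \<tau>) has_sum 2 * ?f \<tau>) (\<tau> - \<rho>)" if "\<tau> \<in> ?T" for \<tau>
      using that finite_simplex[of \<tau>] by (intro has_sum_finiteI) auto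
    have "?f summable_on ?T"
      by (rule summable_on_subset_banach[of ?f S]) (use \<omega> in \<open>auto simp: l2_def\<close>)
    then show "(\<lambda>\<tau>. 2 * ?f \<tau>) summable_on ?T" by (rule summable_on_cmult_right)
    show "0 \<le> (case (\<tau>, u) of (\<tau>, u) \<Rightarrow> ?f \<tau>)" if "\<tau> \<in> ?T" for \<tau> u
      using weight_pos[of \<tau>] that by simp
  qed
  moreover have "?h ` ?P \<subseteq> Sigma ?T (\<lambda>\<tau>. \<tau> - \<rho>)"
  proof
    fix z assume "z \<in> ?h ` ?P"
    then obtain u w where z: "z = ({u, w} \<union> \<rho>, u)" and "link_graph S m \<rho> u w \<noteq> 0" by auto
    then have "u \<notin> \<rho>" "w \<notin> \<rho>" "u \<noteq> w" "{u, w} \<union> \<rho> \<in> S" by (auto simp: link_graph_nonzero_iff)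
    moreover from this have "{u, w} \<union> \<rho> - \<rho> = {u, w}" by auto
    ultimately show "z \<in> Sigma ?T (\<lambda>\<tau>. \<tau> - \<rho>)" unfolding z by auto
  qed
  ultimately have "(\<lambda>(\<tau>, u). ?f \<tau>) summable_on ?h ` ?P"
    by (rule summable_on_subset_banach)
  moreover have "inj_on ?h ?P" by (clarsimp simp: inj_on_def link_graph_nonzero_iff) (metis insert_iff)
  ultimately have "((\<lambda>(\<tau>, u). ?f \<tau>) \<circ> ?h) summable_on ?P"
    by (simp add: summable_on_reindex)
  then have "(\<lambda>(u, w). link_graph S m \<rho> u w * (cmod (\<omega> ({u, w} \<union> \<rho>)))\<^sup>2) summable_on UNIV"
    by (rule summable_on_cong_neutral[THEN iffD1, rotated -1]) (auto dest: link_graph_eq)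
  then show ?thesis by (rule summable_on_subset_banach) simp
qed

section \<open>Solvability of the boundary equation and transience\<close>

text \<open>
  The edge function \<open>A\<close> attached to \<open>\<omega>\<close> is a flow of finite energy with source \<open>\<theta> \<rho> (v\<rho>) * m (v\<rho>) \<noteq> 0\<close>
  at \<open>v\<close>, which a recurrent component cannot carry.
\<close>

lemma transient_component_if_solvable:
  assumes \<rho>: "\<rho> \<in> S" and v: "v \<in> link S \<rho>" and \<omega>: "\<omega> \<in> l2 S m"
    and sol: "\<And>\<tau>. \<tau> \<in> cofaces S \<rho> \<Longrightarrow> boundary S m \<theta> \<omega> \<tau> = indicator {insert v \<rho>} \<tau>"
  shows "\<exists>C\<in>graph_components (link S \<rho>) (link_graph S m \<rho>). v \<in> C \<and> transient_graph C (link_graph S m \<rho>)"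
proof -
  let ?b = "link_graph S m \<rho>"
  define C where "C = {y\<in>link S \<rho>. graph_joined (link S \<rho>) ?b v y}"
  have C: "C \<in> graph_components (link S \<rho>) ?b" and vC: "v \<in> C"
    using v by (auto simp: C_def graph_components_def graph_joined_def)
  interpret weighted_graph C ?b by (rule weighted_graph_link[OF C])
  let ?A = "\<lambda>u w. \<theta> \<rho> (insert u \<rho>) * (\<theta> (insert u \<rho>) ({u, w} \<union> \<rho>) * \<omega> ({u, w} \<union> \<rho>))"
  let ?s = "\<theta> \<rho> (insert v \<rho>) * of_real (m (insert v \<rho>))"
  have "\<not> recurrent_graph C ?b"
  proof
    assume "recurrent_graph C ?b"
    then have "?s = 0"
    proof (rule recurrent_no_finite_energy_flow[OF _ vC])
      show "?b u w * ?A w u = - (?b u w * ?A u w)" for u w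
      proof (cases "?b u w = 0")
        case False
        have "\<theta> \<rho> (insert w \<rho>) * \<theta> (insert w \<rho>) ({w, u} \<union> \<rho>) = - (\<theta> \<rho> (insert u \<rho>) * \<theta> (insert u \<rho>) ({u, w} \<union> \<rho>))"
          using coboundary_squared_two_terms[OF \<rho> False] by (simp add: insert_commute)
        then have "?A w u = - ?A u w" by (simp add: insert_commute flip: mult.assoc)
        then show ?thesis by simp
      qed simp
      show "(\<lambda>(u, w). ?b u w * (cmod (?A u w))\<^sup>2) summable_on C \<times> C"
      proof (rule summable_on_cong[THEN iffD1, OF _ l2_summable_on_link_pairs[OF \<omega>, of \<rho>]])
        fix z assume "z \<in> C \<times> C"
        obtain u w where "z = (u, w)" by (cases z)
        then show "(\<lambda>(u, w). ?b u w * (cmod (\<omega> ({u, w} \<union> \<rho>)))\<^sup>2) z = (\<lambda>(u, w). ?b u w * (cmod (?A u w))\<^sup>2) z"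
          using coeff_square(2)[OF \<rho> link_graph_mem_link(1), of u w] coeff_square_coface(2)[of \<rho> u w]
          by (cases "?b u w = 0") (simp_all add: norm_mult)
      qed
      fix u assume uC: "u \<in> C"
      then have u: "u \<in> link S \<rho>" by (simp add: C_def)
      have "insert u \<rho> \<in> cofaces S \<rho>"
        using u codim1_face_insert[of u \<rho>] by (simp add: cofaces_def mem_link_iff)
      then have bd: "boundary S m \<theta> \<omega> (insert u \<rho>) = indicator {v} u"
        using sol u v by (auto simp: mem_link_iff indicator_def)
      have "((\<lambda>w. ?b u w * (\<theta> (insert u \<rho>) ({u, w} \<union> \<rho>) * \<omega> ({u, w} \<union> \<rho>)))
          has_sum of_real (m (insert u \<rho>)) * indicator {v} u) C"
        unfolding bd[symmetric] using link_graph_component[OF C] uC by (intro has_sum_boundary[OF \<omega> u]) blast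
      from has_sum_cmult_right[OF this, of "\<theta> \<rho> (insert u \<rho>)"]
      show "((\<lambda>w. ?b u w * ?A u w) has_sum ?s * indicator {v} u) C"
        by (cases "u = v") (simp_all add: mult_ac)
    qed
    then show False
      using coeff_square(2)[OF \<rho> v] weight_pos[of "insert v \<rho>"] v by (auto simp: mem_link_iff)
  qed
  then have "transient_graph C ?b"
    using graph_component_connected[OF C link_graph_commute] by (simp add: transient_graph_def)
  then show ?thesis using C vC by blast
qed

text \<open>
  Take a potential \<open>g\<close> of finite energy with \<open>\<Sum>w. b u w * (g u - g w) = 1\<^sub>v u\<close> on the component and let \<open>\<omega>\<close> be
  the coboundary of \<open>u\<rho> \<mapsto> c * \<theta> \<rho> (u\<rho>) * g u\<close>. On the edge \<open>(u, w)\<close> its value is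
  \<open>c * \<theta> \<rho> (u\<rho>) * \<theta> (u\<rho>) ({u, w} \<union> \<rho>) * (g u - g w)\<close>, so that its boundary is the Laplacian of \<open>g\<close> up to
  sign and weight; \<open>c\<close> corrects these at \<open>v\<close>.
\<close>

lemma solvable_if_transient_component:
  assumes \<rho>: "\<rho> \<in> S" and C: "C \<in> graph_components (link S \<rho>) (link_graph S m \<rho>)"
    and trans: "transient_graph C (link_graph S m \<rho>)" and vC: "v \<in> C"
  shows "\<exists>\<omega>\<in>l2 S m. \<forall>\<tau>\<in>cofaces S \<rho>. boundary S m \<theta> \<omega> \<tau> = indicator {insert v \<rho>} \<tau>"
proof -
  let ?b = "link_graph S m \<rho>"
  interpret weighted_graph C ?b by (rule weighted_graph_link[OF C])
  obtain g where energy: "(\<lambda>(u, w). ?b u w * (g u - g w)\<^sup>2) summable_on (C \<times> C)"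
    and lap: "\<And>u. u \<in> C \<Longrightarrow> ((\<lambda>w. ?b u w * (g u - g w)) has_sum indicator {v} u) C"
    by (rule transient_finite_energy_potential[OF trans vC]) blast
  have v: "v \<in> link S \<rho>" using vC graph_component_subset[OF C] by blast
  define c where "c = of_real (m (insert v \<rho>)) * \<theta> \<rho> (insert v \<rho>)"
  define \<omega> where "\<omega> \<tau> = (if \<tau> \<in> S \<and> \<rho> \<subseteq> \<tau> \<and> card (\<tau> - \<rho>) = 2
      then c * (\<Sum>u\<in>(\<tau> - \<rho>) \<inter> C. \<theta> \<rho> (insert u \<rho>) * \<theta> (insert u \<rho>) \<tau> * of_real (g u)) else 0)" for \<tau>
  have \<omega>_edge: "\<omega> ({u, w} \<union> \<rho>)
      = (if u \<in> C then c * (\<theta> \<rho> (insert u \<rho>) * \<theta> (insert u \<rho>) ({u, w} \<union> \<rho>)) * of_real (g u - g w) else 0)"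
    if b: "?b u w \<noteq> 0" for u w
  proof -
    have uw: "u \<notin> \<rho>" "w \<notin> \<rho>" "u \<noteq> w" "{u, w} \<union> \<rho> \<in> S"
      using b by (auto simp: link_graph_nonzero_iff)
    then have diff: "{u, w} \<union> \<rho> - \<rho> = {u, w}" by auto
    show ?thesis
    proof (cases "u \<in> C")
      case True
      then have "{u, w} \<inter> C = {u, w}" using link_graph_component[OF C b] by auto
      then show ?thesis
        using uw diff True coboundary_squared_two_terms[OF \<rho> b] by (auto simp: \<omega>_def right_diff_distrib)
    next
      case False
      then have "{u, w} \<inter> C = {}" using link_graph_component[OF C b] by auto
      then show ?thesis using diff False by (simp add: \<omega>_def)
    qed
  qed
  have "\<omega> \<in> l2 S m"
  proof -
    let ?T = "{\<tau>\<in>S. \<omega> \<tau> \<noteq> 0}"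
    \<comment> \<open>Choosing one orientation of each simplex in the support embeds it into the edges of the component.\<close>
    have "\<exists>z. z \<in> C \<times> C \<and> ?b (fst z) (snd z) \<noteq> 0 \<and> \<tau> = {fst z, snd z} \<union> \<rho>" if "\<tau> \<in> ?T" for \<tau>
    proof -
      have \<tau>: "\<tau> \<in> S" "\<rho> \<subseteq> \<tau>" "card (\<tau> - \<rho>) = 2" using that by (auto simp: \<omega>_def split: if_splits)
      then obtain u w where uw: "\<tau> - \<rho> = {u, w}" "u \<noteq> w" by (auto simp: card_2_iff)
      then have \<tau>_eq: "\<tau> = {u, w} \<union> \<rho>" using \<tau> by auto
      then have b: "?b u w \<noteq> 0" using uw \<tau> by (auto simp: link_graph_nonzero_iff)
      then have "u \<in> C" using \<omega>_edge[OF b] that \<tau>_eq by (auto split: if_splits)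
      then show ?thesis using b \<tau>_eq link_graph_component[OF C b] by (intro exI[of _ "(u, w)"]) auto
    qed
    then obtain e where e: "\<And>\<tau>. \<tau> \<in> ?T \<Longrightarrow> e \<tau> \<in> C \<times> C \<and> ?b (fst (e \<tau>)) (snd (e \<tau>)) \<noteq> 0
        \<and> \<tau> = {fst (e \<tau>), snd (e \<tau>)} \<union> \<rho>" by metis
    let ?E = "\<lambda>(u, w). ?b u w * (g u - g w)\<^sup>2"
    have "?E summable_on e ` ?T"
      by (rule summable_on_subset_banach[OF energy]) (use e in blast)
    moreover have "inj_on e ?T" using e by (metis (no_types, lifting) inj_onI)
    ultimately have "(?E \<circ> e) summable_on ?T" by (simp add: summable_on_reindex)
    then have "(\<lambda>\<tau>. (cmod c)\<^sup>2 * (?E \<circ> e) \<tau>) summable_on ?T" by (rule summable_on_cmult_right)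
    then have "(\<lambda>\<tau>. m \<tau> * (cmod (\<omega> \<tau>))\<^sup>2) summable_on S"
    proof (rule summable_on_cong_neutral[THEN iffD1, rotated -1])
      fix \<tau> assume "\<tau> \<in> ?T \<inter> S"
      then have \<tau>: "\<tau> \<in> ?T" by blast
      obtain u w where uw: "e \<tau> = (u, w)" by (cases "e \<tau>")
      have u: "u \<in> C" and b: "?b u w \<noteq> 0" and \<tau>_eq: "\<tau> = {u, w} \<union> \<rho>" using e[OF \<tau>] uw by auto
      have "cmod (\<omega> \<tau>) = cmod c * \<bar>g u - g w\<bar>"
        unfolding \<tau>_eq \<omega>_edge[OF b]
        using u coeff_square(2)[OF \<rho> link_graph_mem_link(1)[OF b]] coeff_square_coface(2)[OF b]
        by (simp add: norm_mult flip: of_real_diff)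
      then show "(cmod c)\<^sup>2 * (?E \<circ> e) \<tau> = m \<tau> * (cmod (\<omega> \<tau>))\<^sup>2"
        using uw link_graph_eq[OF b] \<tau>_eq by (simp add: power_mult_distrib)
    qed auto
    then show ?thesis by (simp add: l2_def)
  qed
  moreover have "boundary S m \<theta> \<omega> \<tau> = indicator {insert v \<rho>} \<tau>" if \<tau>: "\<tau> \<in> cofaces S \<rho>" for \<tau>
  proof -
    obtain u where u: "u \<in> link S \<rho>" and \<tau>_eq: "\<tau> = insert u \<rho>"
      using \<tau> by (auto simp: cofaces_def mem_link_iff elim: codim1_faceE)
    let ?F = "\<lambda>w. ?b u w * (\<theta> (insert u \<rho>) ({u, w} \<union> \<rho>) * \<omega> ({u, w} \<union> \<rho>))"
    \<comment> \<open>If \<open>u\<close> lies outside \<open>C\<close>, then so do its neighbours and \<open>\<omega>\<close> vanishes on the edges at \<open>u\<close>.\<close>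
    have "(?F has_sum (if u \<in> C then c * \<theta> \<rho> (insert u \<rho>) * indicator {v} u else 0)) (if u \<in> C then C else UNIV)"
    proof (cases "u \<in> C")
      case True
      have F: "?F w = c * \<theta> \<rho> (insert u \<rho>) * of_real (?b u w * (g u - g w))" for w
      proof (cases "?b u w = 0")
        case False
        have "?F w = ?b u w * (c * \<theta> \<rho> (insert u \<rho>) * of_real (g u - g w))
            * (\<theta> (insert u \<rho>) ({u, w} \<union> \<rho>) * \<theta> (insert u \<rho>) ({u, w} \<union> \<rho>))"
          unfolding \<omega>_edge[OF False] using True by (simp add: mult_ac)
        then show ?thesis
          unfolding coeff_square_coface(1)[OF False] by (simp add: mult.assoc mult.left_commute)
      qed simp
      have "of_real (indicator {v} u :: real) = (indicator {v} u :: complex)"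
        by (simp add: indicator_def)
      then have "((\<lambda>w. c * \<theta> \<rho> (insert u \<rho>) * of_real (?b u w * (g u - g w)))
          has_sum c * \<theta> \<rho> (insert u \<rho>) * indicator {v} u) C"
        using has_sum_cmult_right[OF has_sum_of_real[OF lap[OF True]], of "c * \<theta> \<rho> (insert u \<rho>)"]
        by (simp only:)
      then show ?thesis unfolding F using True by (simp only: if_True)
    next
      case False
      have F: "?F w = 0" for w using \<omega>_edge[of u w] False by (cases "?b u w = 0") auto
      show ?thesis unfolding F using False by simp
    qed
    then have "boundary S m \<theta> \<omega> (insert u \<rho>)
        = (if u \<in> C then c * \<theta> \<rho> (insert u \<rho>) * indicator {v} u else 0) / of_real (m (insert u \<rho>))"
      using boundary_eqI[OF u, where \<omega> = \<omega> and V = "if u \<in> C then C else UNIV"]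
        link_graph_component[OF C] by (cases "u \<in> C") (simp_all only: if_True if_False, auto)
    also have "\<dots> = indicator {v} u"
      using coeff_square(1)[OF \<rho> v] weight_pos[of "insert v \<rho>"] v vC
      by (auto simp: c_def mem_link_iff indicator_def mult.assoc)
    also have "\<dots> = indicator {insert v \<rho>} \<tau>"
      using u v \<tau>_eq by (auto simp: mem_link_iff indicator_def)
    finally show ?thesis using \<tau>_eq by simp
  qed
  ultimately show ?thesis by blast
qed

end

theorem theorem5p5:
  fixes X :: "'a set" and K S :: "'a set set" and m :: "'a set \<Rightarrow> real"
    and \<theta> :: "'a set \<Rightarrow> 'a set \<Rightarrow> complex"
  assumes "weighted_simplicial_complex X K m S"
    and "coboundary_coeffs S \<theta>"
  shows
    "(\<forall>d::int. complex_dim S = ereal (of_int d) \<longrightarrow>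
        (\<forall>\<sigma>\<in>simplices S (d - 1). \<exists>\<omega>\<in>l2 S m.
            (\<forall>\<tau>\<in>S. \<omega> \<tau> \<noteq> 0 \<longrightarrow> \<tau> \<in> simplices S d) \<and>
            (\<forall>\<tau>\<in>S. boundary S m \<theta> \<omega> \<tau> = indicator {\<sigma>} \<tau>)) \<longrightarrow>
        (\<forall>\<rho>\<in>simplices S (d - 2). link S \<rho> \<noteq> {} \<longrightarrow>
            (\<exists>C\<in>graph_components (link S \<rho>) (link_graph S m \<rho>).
                transient_graph C (link_graph S m \<rho>)))) \<and>
     (\<forall>\<rho>\<in>S. \<forall>C\<in>graph_components (link S \<rho>) (link_graph S m \<rho>).
        transient_graph C (link_graph S m \<rho>) \<longrightarrow>
        (\<forall>v\<in>C. \<exists>\<omega>\<in>l2 S m. \<forall>\<tau>\<in>cofaces S \<rho>.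
            boundary S m \<theta> \<omega> \<tau> = indicator {insert v \<rho>} \<tau>))"
proof -
  interpret oriented_complex X K S m \<theta> by standard (use assms in auto)
  have "\<exists>C\<in>graph_components (link S \<rho>) (link_graph S m \<rho>). transient_graph C (link_graph S m \<rho>)"
    if solvable: "\<forall>\<sigma>\<in>simplices S (d - 1). \<exists>\<omega>\<in>l2 S m.
            (\<forall>\<tau>\<in>S. \<omega> \<tau> \<noteq> 0 \<longrightarrow> \<tau> \<in> simplices S d) \<and>
            (\<forall>\<tau>\<in>S. boundary S m \<theta> \<omega> \<tau> = indicator {\<sigma>} \<tau>)"
      and \<rho>: "\<rho> \<in> simplices S (d - 2)" and link: "link S \<rho> \<noteq> {}" for d and \<rho> :: "'a set"
  proof -
    obtain v where v: "v \<in> link S \<rho>" using link by blast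
    have "insert v \<rho> \<in> simplices S (d - 1)"
      using v \<rho> finite_simplex[of \<rho>] by (auto simp: simplices_def simplex_dim_def mem_link_iff)
    then obtain \<omega> where "\<omega> \<in> l2 S m" "\<forall>\<tau>\<in>S. boundary S m \<theta> \<omega> \<tau> = indicator {insert v \<rho>} \<tau>"
      using solvable by blast
    then show ?thesis
      using transient_component_if_solvable[of \<rho> v \<omega>] \<rho> v by (auto simp: simplices_def cofaces_def)
  qed
  then show ?thesis using solvable_if_transient_component by blast
qed

end
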